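(* Let $h=\frac1n\sum_{i=1}^nh_i$ with $h_i:\mathbb R^d\to\mathbb R^d$, and let $W:\mathbb R^d\to\mathbb R_+$ be Borel. Assume: (A) there are $c_{h,0},c_{h,1}\in\mathbb R_+$ such that $\|h(w)\|^2\le c_{h,0}+c_{h,1}W(w)$ for all $w\in\mathbb R^d$; (B) there is a continuously differentiable $V:\mathbb R^d\to\mathbb R$ with $V_\star:=\inf V>-\infty$, with $L_V$-Lipschitz gradient, and $\rho>0$ with $\langle\nabla V(w),h(w)\rangle\le-\rho W(w)$ for all $w\in\mathbb R^d$; (C) for each $i\in\{1,\dots,n\}$ there is $L_i\ge0$ with $\|h_i(w)-h_i(w')\|\le L_i\|w-w'\|$ for all $w,w'\in\mathbb R^d$; set $L^2:=\frac1n\sum_{i=1}^nL_i^2$. Let $k_{\rm in},k_{\rm out}$ be positive integers, $w_{\rm init}\in\mathbb R^d$, and let $\{\gamma_{t,k}:1\le t\le k_{\rm out},1\le k\le k_{\rm in}\}$ be positive step sizes such that for all $t$ and all $k\ge1$: $\gamma_{t,k+1}\le\gamma_{t,k}$ and $$(1\vee c_{h,1})\,\gamma_{t,k}\,\lambda_{t,k}\in(0,\rho/2),\qquad\lambda_{t,k}:=L_V+\gamma_{t,k}L^2\{c_V^2\rho^{-1}+\rho\}\frac{k_{\rm in}}{b}.$$ Let $(w_{t,k})$ and $(H_{t,k})$ be generated by the SA-SPIDER algorithm (described in the context) with batch size $b$. Then $$\sum_{t=1}^{k_{\rm out}}\sum_{k=1}^{k_{\rm in}}\gamma_{t,k}\Big(\frac\rho2-c_{h,1}\gamma_{t,k}\lambda_{t,k}\Big)\mathbb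 E[W(w_{t,k-1})]+\sum_{t=1}^{k_{\rm out}}\sum_{k=1}^{k_{\rm in}}\gamma_{t,k}\Big(\frac\rho2-\gamma_{t,k}\lambda_{t,k}\Big)\mathbb E[\|H_{t,k}-h(w_{t,k-1})\|^2]$$ $$\le\mathbb E[V(w_{\rm init})]-V_\star+c_{h,0}\Big\{L_V\sum_{t=1}^{k_{\rm out}}\sum_{k=1}^{k_{\rm in}}\gamma_{t,k}^2+\frac{L^2k_{\rm in}}{b}\Big(\frac{c_V^2}{\rho}+\rho\Big)\sum_{t=1}^{k_{\rm out}}\sum_{k=1}^{k_{\rm in}}\gamma_{t,k}^3\Big\}.$$
   Context: $c_V\in(0,+\infty]$ is a constant such that $\|\nabla V(w)\|\le c_V\sqrt{W(w)}$ for all $w\in\mathbb R^d$ (convention $0\cdot\infty=0$). SA-SPIDER algorithm. Inputs: $w_{\rm init}$, $k_{\rm in}$, $k_{\rm out}$, a batch size $b$, step sizes $\gamma_{t,k+1}$, $1\le t\le k_{\rm out}$, $0\le k\le k_{\rm in}-1$. Set $w_{0,k_{\rm in}}:=w_{\rm init}$. For $t=1,\dots,k_{\rm out}$: set $w_{t,0}:=w_{t-1,k_{\rm in}}$, $w_{t,-1}:=w_{t-1,k_{\rm in}}$ and $H_{t,0}:=h(w_{t,0})$; then for $k=0,\dots,k_{\rm in}-1$: sample a mini-batch $\mathcal B_{t,k+1}$ of $b$ indices uniformly in $\{1,\dots,n\}$, with or without replacement, independently of the past; set $$H_{t,k+1}:=H_{t,k}+\frac1b\sum_{i\in\mathcal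 B_{t,k+1}}\{h_i(w_{t,k})-h_i(w_{t,k-1})\},\qquad w_{t,k+1}:=w_{t,k}+\gamma_{t,k+1}H_{t,k+1}.$$ *)

theory Defs
  imports "HOL-Probability.Probability"
begin

definition mean_field :: "nat \<Rightarrow> (nat \<Rightarrow> 'v \<Rightarrow> 'v) \<Rightarrow> 'v \<Rightarrow> 'v::real_normed_vector" where
  "mean_field n hs w = (1 / real n) *\<^sub>R (\<Sum>i=1..n. hs i w)"

(* A mini-batch is recorded in the order in which its b indices are drawn, so that repeated
   indices are counted with multiplicity.  Drawing without replacement (repl = False) is the
   uniform law on the repetition-free sequences; its underlying set of indices is then a
   uniformly distributed b-element subset of {1..n}. *)
definition batches :: "bool \<Rightarrow> nat \<Rightarrow> nat \<Rightarrow> nat list set" where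
  "batches repl n b = {xs. length xs = b \<and> set xs \<subseteq> {1..n} \<and> (repl \<or> distinct xs)}"

(* The inner loop for one t, started at w0, with step sizes g 1, g 2, ... and mini-batches
   B 1, B 2, ...  The state after k steps is (w_{t,k}, w_{t,k-1}, H_{t,k}). *)
primrec spider_inner ::
  "nat \<Rightarrow> (nat \<Rightarrow> 'v \<Rightarrow> 'v) \<Rightarrow> nat \<Rightarrow> (nat \<Rightarrow> real) \<Rightarrow> (nat \<Rightarrow> nat list) \<Rightarrow> 'v
     \<Rightarrow> nat \<Rightarrow> 'v \<times> 'v \<times> 'v::real_normed_vector" where
  "spider_inner n hs b g B w0 0 = (w0, w0, mean_field n hs w0)"
| "spider_inner n hs b g B w0 (Suc k) =
     (let (w, w', H) = spider_inner n hs b g B w0 k;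
          H\<^sub>1 = H + (1 / real b) *\<^sub>R (\<Sum>i\<leftarrow>B (Suc k). hs i w - hs i w')
      in (w + g (Suc k) *\<^sub>R H\<^sub>1, w, H\<^sub>1))"

(* The last iterate w_{t,kin} of the outer iteration t; for t = 0 it is the initial point. *)
primrec spider_outer ::
  "nat \<Rightarrow> (nat \<Rightarrow> 'v \<Rightarrow> 'v) \<Rightarrow> nat \<Rightarrow> nat \<Rightarrow> (nat \<Rightarrow> nat \<Rightarrow> real) \<Rightarrow> (nat \<Rightarrow> nat \<Rightarrow> nat list) \<Rightarrow> 'v
     \<Rightarrow> nat \<Rightarrow> 'v::real_normed_vector" where
  "spider_outer n hs b kin g B winit 0 = winit"
| "spider_outer n hs b kin g B winit (Suc t) =
     fst (spider_inner n hs b (g (Suc t)) (B (Suc t)) (spider_outer n hs b kin g B winit t) kin)"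

(* The iterates w_{t,k} and H_{t,k}, for t >= 1 and 0 <= k <= kin. *)
definition spider_w ::
  "nat \<Rightarrow> (nat \<Rightarrow> 'v \<Rightarrow> 'v) \<Rightarrow> nat \<Rightarrow> nat \<Rightarrow> (nat \<Rightarrow> nat \<Rightarrow> real) \<Rightarrow> (nat \<Rightarrow> nat \<Rightarrow> nat list) \<Rightarrow> 'v
     \<Rightarrow> nat \<Rightarrow> nat \<Rightarrow> 'v::real_normed_vector" where
  "spider_w n hs b kin g B winit t k =
     fst (spider_inner n hs b (g t) (B t) (spider_outer n hs b kin g B winit (t - 1)) k)"

definition spider_H ::
  "nat \<Rightarrow> (nat \<Rightarrow> 'v \<Rightarrow> 'v) \<Rightarrow> nat \<Rightarrow> nat \<Rightarrow> (nat \<Rightarrow> nat \<Rightarrow> real) \<Rightarrow> (nat \<Rightarrow> nat \<Rightarrow> nat list) \<Rightarrow> 'v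
     \<Rightarrow> nat \<Rightarrow> nat \<Rightarrow> 'v::real_normed_vector" where
  "spider_H n hs b kin g B winit t k =
     snd (snd (spider_inner n hs b (g t) (B t) (spider_outer n hs b kin g B winit (t - 1)) k))"

lemma spider_inner_prev:
  "fst (snd (spider_inner n hs b g B w0 k)) = fst (spider_inner n hs b g B w0 (k - 1))"
  by (cases k) (auto simp: Let_def split: prod.splits)

lemma spider_start:
  "spider_w n hs b kin g B winit 1 0 = winit"
  "1 \<le> t \<Longrightarrow> spider_w n hs b kin g B winit (Suc t) 0 = spider_w n hs b kin g B winit t kin"
  "spider_H n hs b kin g B winit t 0 = mean_field n hs (spider_w n hs b kin g B winit t 0)"
  subgoal by (simp add: spider_w_def)
  subgoal by (cases t) (simp_all add: spider_w_def)
  subgoal by (simp add: spider_w_def spider_H_def)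
  done

(* For k = 0 the truncated k - 1 denotes 0, in accordance with w_{t,-1} = w_{t,0}. *)
lemma spider_step:
  assumes "w = spider_w n hs b kin g B winit" and "H = spider_H n hs b kin g B winit"
  shows "H t (Suc k) = H t k
           + (1 / real b) *\<^sub>R (\<Sum>i\<leftarrow>B t (Suc k). hs i (w t k) - hs i (w t (k - 1)))"
    and "w t (Suc k) = w t k + g t (Suc k) *\<^sub>R H t (Suc k)"
  unfolding assms spider_w_def spider_H_def spider_inner_prev[symmetric]
  by (auto simp: Let_def split: prod.splits)

(* Extended-real valued because cV = \<infinity> is allowed; the library's 0 * \<infinity> = 0 makes the second
   summand vanish when L2 (the mean of the squared Lipschitz constants) is 0. *)
definition spider_lambda :: "real \<Rightarrow> real \<Rightarrow> ereal \<Rightarrow> real \<Rightarrow> nat \<Rightarrow> nat \<Rightarrow> real \<Rightarrow> ereal" where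
  "spider_lambda LV L2 cV \<rho> kin b \<gamma> =
     ereal LV + ereal (\<gamma> * L2) * (cV\<^sup>2 / ereal \<rho> + ereal \<rho>) * ereal (real kin / real b)"

end

theory Submission
  imports Defs
begin

text \<open>
  Write $D_{t,k} = H_{t,k} - h(w_{t,k-1})$ for the error of the estimated field. Along one inner
  loop three one-step estimates are available in expectation.

  Descent: the smoothness of $V$ gives
  $V(w_{t,k}) \le V(w_{t,k-1}) + \gamma\langle\nabla V, H\rangle + \frac{L_V}{2}\gamma^2\|H\|^2$.
  Splitting $H = h + D$, the drift condition contributes $-\rho W$, and Young's inequality together
  with the bound on $\nabla V$ turns $\langle\nabla V, D\rangle$ into
  $\frac{\rho}{2} W + \frac{K-\rho}{2}\|D\|^2$ where $K = c_V^2/\rho + \rho$.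

  Size of the field: $\|H\|^2 \le 2\|h\|^2 + 2\|D\|^2 \le 2(c_{h,0} + c_{h,1} W + \|D\|^2)$.

  Variance: $D_{t,k+1}$ is $D_{t,k}$ plus a centred mini-batch mean that is conditionally independent
  of the past, so the cross term vanishes and the mean square grows by at most the variance of that
  mean, $\frac{L^2}{b}\|w_{t,k} - w_{t,k-1}\|^2 = \frac{L^2}{b}\gamma_{t,k}^2\|H_{t,k}\|^2$.

  Since $D_{t,1} = 0$ and the steps decrease, the variance recursion bounds each
  $\gamma_{t,k}\mathbb E\|D_{t,k}\|^2$ by $\frac{L^2}{b}\sum_j\gamma_{t,j}^3\mathbb E\|H_{t,j}\|^2$.
  Adding up the descent inequalities and using the size estimate collects exactly the coefficient
  $\lambda_{t,k}$ (\<open>inner_loop_summation\<close>); the outer loops telescope, each one starting where the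
  previous one stopped.

  Two points need care. For drawing without replacement the terms of a batch mean are negatively
  correlated; \<open>sum_batches_norm_sum_le\<close> treats both sampling schemes by one induction on the batch
  size. If $c_V = \infty$, the step size condition forces $L = 0$; then $D$ vanishes almost surely
  and $K = \rho$ can be used. All random quantities almost surely take finitely many values, because they
  are functions of finitely many batches; this settles integrability, and it reduces conditioning
  on the past to a finite sum over the values of the next batch (\<open>expectation_average_fresh\<close>).
\<close>

section \<open>Second moments of mini-batch means\<close>

lemma finite_batches [simp]: "finite (batches repl n b)"
  by (rule finite_subset[OF _ finite_lists_length_eq[of "{1..n}" b]]) (auto simp: batches_def)

lemma batches_nonempty:
  assumes "1 \<le> n" "repl \<or> b \<le> n"
  shows "batches repl n b \<noteq> {}"
proof (cases repl)
  case True
  have "replicate b 1 \<in> batches repl n b"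
    using assms True by (auto simp: batches_def)
  then show ?thesis by auto
next
  case False
  have "[1..<Suc b] \<in> batches repl n b"
    using assms False by (auto simp: batches_def)
  then show ?thesis by auto
qed

lemma batches_0: "batches repl n 0 = {[]}"
  by (auto simp: batches_def)

text \<open>The indices that may still be drawn after \<open>ys\<close>; they are put in front of \<open>ys\<close>.\<close>

definition available :: "bool \<Rightarrow> nat \<Rightarrow> nat list \<Rightarrow> nat set" where
  "available repl n ys = (if repl then {1..n} else {1..n} - set ys)"

lemma finite_available [simp]: "finite (available repl n ys)"
  by (simp add: available_def)

lemma batches_Suc:
  "batches repl n (Suc b) =
     (\<lambda>(ys, i). i # ys) ` (SIGMA ys : batches repl n b. available repl n ys)"
proof (rule set_eqI)
  fix xs
  show "xs \<in> batches repl n (Suc b) \<longleftrightarrow>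
    xs \<in> (\<lambda>(ys, i). i # ys) ` (SIGMA ys : batches repl n b. available repl n ys)"
    by (cases xs) (auto simp: batches_def available_def image_iff)
qed

lemma sum_batches_Suc:
  "(\<Sum>xs\<in>batches repl n (Suc b). f xs) =
     (\<Sum>ys\<in>batches repl n b. \<Sum>i\<in>available repl n ys. f (i # ys))"
  unfolding batches_Suc
  by (subst sum.reindex) (auto simp: inj_on_def sum.Sigma split_def)

text \<open>
  The two sampling schemes differ only in the factor \<open>of_bool (\<not> repl)\<close> of the correction for the
  indices already drawn. All further computations carry this factor along as a number and hence
  cover both schemes at once.
\<close>

lemma sum_available:
  fixes f :: "nat \<Rightarrow> 'a::real_vector"
  assumes "ys \<in> batches repl n b"
  shows "(\<Sum>i\<in>available repl n ys. f i)
           = (\<Sum>i=1..n. f i) - of_bool (\<not> repl) *\<^sub>R (\<Sum>i\<leftarrow>ys. f i)"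
proof (cases repl)
  case False
  then have "distinct ys" "set ys \<subseteq> {1..n}"
    using assms by (auto simp: batches_def)
  then show ?thesis
    using False by (simp add: available_def sum_diff sum_list_distinct_conv_sum_set)
qed (simp add: available_def)

lemma card_available:
  assumes "ys \<in> batches repl n b"
  shows "real (card (available repl n ys)) = real n - of_bool (\<not> repl) * real b"
  using sum_available[OF assms, of "\<lambda>_. 1::real"] assms
  by (simp add: batches_def sum_list_triv)

lemma card_batches_Suc:
  "real (card (batches repl n (Suc b)))
     = (real n - of_bool (\<not> repl) * real b) * real (card (batches repl n b))"
proof -
  have "real (card (batches repl n (Suc b))) = (\<Sum>xs\<in>batches repl n (Suc b). 1)"
    by simp
  also have "\<dots> = (\<Sum>ys\<in>batches repl n b. real (card (available repl n ys)))"
    unfolding sum_batches_Suc by simp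
  also have "\<dots> = (\<Sum>ys\<in>batches repl n b. real n - of_bool (\<not> repl) * real b)"
    by (intro sum.cong refl card_available)
  finally show ?thesis by simp
qed

text \<open>
  Each position of a random batch is uniformly distributed on the indices, whence a batch sum has
  \<open>b\<close> times the population mean as its expectation. The identity is multiplied by \<open>n\<close> and by the
  number of batches so that no division occurs in the induction.
\<close>

lemma sum_batches_linear:
  fixes f :: "nat \<Rightarrow> 'a::real_vector"
  shows "real n *\<^sub>R (\<Sum>xs\<in>batches repl n b. \<Sum>i\<leftarrow>xs. f i)
           = (real b * real (card (batches repl n b))) *\<^sub>R (\<Sum>i=1..n. f i)"
proof (induction b)
  case 0
  then show ?case by (simp add: batches_0)
next
  case (Suc b)
  define e :: real where "e = of_bool (\<not> repl)"
  define N where "N = real (card (batches repl n b))"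
  define U where "U = (\<Sum>xs\<in>batches repl n b. \<Sum>i\<leftarrow>xs. f i)"
  define A where "A = (\<Sum>i=1..n. f i)"
  have "(\<Sum>xs\<in>batches repl n (Suc b). \<Sum>i\<leftarrow>xs. f i)
      = (\<Sum>ys\<in>batches repl n b. (\<Sum>i\<in>available repl n ys. f i)
           + real (card (available repl n ys)) *\<^sub>R (\<Sum>i\<leftarrow>ys. f i))"
    unfolding sum_batches_Suc by (simp add: sum.distrib sum_constant_scaleR)
  also have "\<dots> = (\<Sum>ys\<in>batches repl n b. A + (real n - e * real b - e) *\<^sub>R (\<Sum>i\<leftarrow>ys. f i))"
    by (intro sum.cong refl) (simp add: sum_available card_available A_def e_def algebra_simps)
  also have "\<dots> = N *\<^sub>R A + (real n - e * real b - e) *\<^sub>R U"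
    by (simp add: sum.distrib sum_constant_scaleR N_def U_def scaleR_sum_right)
  finally have "real n *\<^sub>R (\<Sum>xs\<in>batches repl n (Suc b). \<Sum>i\<leftarrow>xs. f i)
      = (real n * N) *\<^sub>R A + (real n - e * real b - e) *\<^sub>R (real n *\<^sub>R U)"
    by (simp only: scaleR_add_right scaleR_scaleR mult.commute)
  also have "real n *\<^sub>R U = (real b * N) *\<^sub>R A"
    using Suc.IH by (simp add: U_def A_def N_def)
  also have "(real n * N) *\<^sub>R A + (real n - e * real b - e) *\<^sub>R ((real b * N) *\<^sub>R A)
      = (real (Suc b) * ((real n - e * real b) * N)) *\<^sub>R A"
    by (simp add: algebra_simps)
  also have "(real n - e * real b) * N = real (card (batches repl n (Suc b)))"
    by (simp add: card_batches_Suc e_def N_def)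
  finally show ?case by (simp add: A_def)
qed

text \<open>
  The expected squared norm of a centred batch sum is at most that of \<open>b\<close> independent draws. When
  one more index is drawn, the cross term is the inner product of the old sum \<open>s\<close> with the sum of
  the available terms. By centring, the latter is zero with replacement and \<open>- s\<close> without; thus the
  cross term has a favourable sign and can be dropped. The remaining recursion is satisfied with
  equality by the claimed bound.
\<close>

lemma sum_batches_norm_sum_le:
  fixes a :: "nat \<Rightarrow> 'a::real_inner"
  assumes "repl \<or> b \<le> n" and centred: "(\<Sum>i=1..n. a i) = 0"
  shows "real n * (\<Sum>xs\<in>batches repl n b. (norm (\<Sum>i\<leftarrow>xs. a i))\<^sup>2)
           \<le> real b * real (card (batches repl n b)) * (\<Sum>i=1..n. (norm (a i))\<^sup>2)"
  using assms(1)
proof (induction b)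
  case 0
  then show ?case by (simp add: batches_0)
next
  case (Suc b)
  define e :: real where "e = of_bool (\<not> repl)"
  define N where "N = real (card (batches repl n b))"
  define c where "c = real n - e * real b"
  define T where "T = (\<Sum>xs\<in>batches repl n b. (norm (\<Sum>i\<leftarrow>xs. a i))\<^sup>2)"
  define R where "R = (\<Sum>xs\<in>batches repl n b. \<Sum>i\<leftarrow>xs. (norm (a i))\<^sup>2)"
  define Q where "Q = (\<Sum>i=1..n. (norm (a i))\<^sup>2)"
  have "0 \<le> c" using Suc.prems by (auto simp: c_def e_def)
  have "0 \<le> e" by (simp add: e_def)
  have "0 \<le> T" by (auto simp: T_def intro: sum_nonneg)
  have step: "(\<Sum>i\<in>available repl n ys. (norm (a i + (\<Sum>i\<leftarrow>ys. a i)))\<^sup>2)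
      = (c - 2 * e) * (norm (\<Sum>i\<leftarrow>ys. a i))\<^sup>2 + Q - e * (\<Sum>i\<leftarrow>ys. (norm (a i))\<^sup>2)"
    if ys: "ys \<in> batches repl n b" for ys
  proof -
    let ?s = "\<Sum>i\<leftarrow>ys. a i"
    have "(\<Sum>i\<in>available repl n ys. (norm (a i + ?s))\<^sup>2)
        = (\<Sum>i\<in>available repl n ys. (norm (a i))\<^sup>2 + 2 * (a i \<bullet> ?s) + (norm ?s)\<^sup>2)"
      by (intro sum.cong refl) (simp add: power2_norm_eq_inner algebra_simps inner_commute)
    also have "\<dots> = (\<Sum>i\<in>available repl n ys. (norm (a i))\<^sup>2)
        + 2 * ((\<Sum>i\<in>available repl n ys. a i) \<bullet> ?s) + real (card (available repl n ys)) * (norm ?s)\<^sup>2"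
      by (simp add: sum.distrib inner_sum_left sum_distrib_left)
    also have "\<dots> = Q - e * (\<Sum>i\<leftarrow>ys. (norm (a i))\<^sup>2) - 2 * e * (norm ?s)\<^sup>2 + c * (norm ?s)\<^sup>2"
      using sum_available[OF ys, of a] sum_available[OF ys, of "\<lambda>i. (norm (a i))\<^sup>2"] card_available[OF ys]
      by (simp add: centred Q_def e_def c_def power2_norm_eq_inner del: One_nat_def)
    finally show ?thesis by (simp add: algebra_simps)
  qed
  have R: "real n * R = real b * N * Q"
    using sum_batches_linear[of n "\<lambda>i. (norm (a i))\<^sup>2" repl b] by (simp add: R_def N_def Q_def)
  have IH: "real n * T \<le> real b * N * Q"
    using Suc.IH Suc.prems unfolding T_def N_def Q_def by linarith
  have "real n * (\<Sum>xs\<in>batches repl n (Suc b). (norm (\<Sum>i\<leftarrow>xs. a i))\<^sup>2)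
      = real n * ((c - 2 * e) * T + N * Q - e * R)"
    unfolding sum_batches_Suc
    by (simp add: step sum.distrib sum_subtractf T_def R_def N_def sum_distrib_left)
  also have "\<dots> = c * (real n * T) - 2 * e * (real n * T) + real n * N * Q - e * (real n * R)"
    by (simp add: algebra_simps)
  also have "\<dots> \<le> c * (real b * N * Q) + real n * N * Q - e * (real b * N * Q)"
    unfolding R using mult_left_mono[OF IH \<open>0 \<le> c\<close>] 
      mult_nonneg_nonneg[OF \<open>0 \<le> e\<close> mult_nonneg_nonneg[OF of_nat_0_le_iff \<open>0 \<le> T\<close>], of n]
    by linarith
  also have "\<dots> = real (Suc b) * (c * N) * Q"
    by (simp add: c_def algebra_simps)
  also have "c * N = real (card (batches repl n (Suc b)))"
    by (simp add: card_batches_Suc c_def e_def N_def)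
  finally show ?case by (simp add: Q_def)
qed

lemma sum_list_diff_const:
  fixes f :: "'b \<Rightarrow> 'a::real_vector"
  shows "(\<Sum>i\<leftarrow>xs. f i - c) = (\<Sum>i\<leftarrow>xs. f i) - real (length xs) *\<^sub>R c"
  by (induction xs) (auto simp: algebra_simps)

text \<open>
  Bias-variance decomposition for a deterministic \<open>D\<close>: the centred batch mean is orthogonal to \<open>D\<close>
  on average, and its variance is bounded by the uncentred second moment of \<open>\<delta>\<close> divided by \<open>b\<close>.
\<close>

lemma batch_mean_second_moment:
  fixes D :: "'a::real_inner" and \<delta> :: "nat \<Rightarrow> 'a"
  assumes n: "1 \<le> n" and b: "1 \<le> b" and repl: "repl \<or> b \<le> n"
  shows "(\<Sum>xs\<in>batches repl n b.
             (norm (D + (1 / real b) *\<^sub>R (\<Sum>i\<leftarrow>xs. \<delta> i) - (1 / real n) *\<^sub>R (\<Sum>i=1..n. \<delta> i)))\<^sup>2)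
           / real (card (batches repl n b))
         \<le> (norm D)\<^sup>2 + (\<Sum>i=1..n. (norm (\<delta> i))\<^sup>2) / (real b * real n)"
proof -
  define m where "m = (1 / real n) *\<^sub>R (\<Sum>i=1..n. \<delta> i)"
  define a where "a i = \<delta> i - m" for i
  define S where "S = batches repl n b"
  define N where "N = real (card S)"
  have N: "0 < N"
    using batches_nonempty[OF n repl] by (simp add: N_def S_def card_gt_0_iff)
  have nm: "(\<Sum>i=1..n. \<delta> i) = real n *\<^sub>R m"
    unfolding m_def using n by simp
  have a0: "(\<Sum>i=1..n. a i) = 0"
    by (simp add: a_def sum_subtractf sum_constant_scaleR nm del: One_nat_def)
  have lin: "(\<Sum>xs\<in>S. \<Sum>i\<leftarrow>xs. a i) = 0"
    using sum_batches_linear[of n a repl b] a0 n by (simp add: S_def)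
  have "(\<Sum>i=1..n. (norm (a i))\<^sup>2) = (\<Sum>i=1..n. (norm (\<delta> i))\<^sup>2 - 2 * (\<delta> i \<bullet> m) + (norm m)\<^sup>2)"
    by (intro sum.cong refl) (simp add: a_def power2_norm_eq_inner algebra_simps inner_commute)
  also have "\<dots> = (\<Sum>i=1..n. (norm (\<delta> i))\<^sup>2) - 2 * ((\<Sum>i=1..n. \<delta> i) \<bullet> m) + real n * (norm m)\<^sup>2"
    by (simp add: sum.distrib sum_subtractf inner_sum_left sum_distrib_left)
  also have "\<dots> \<le> (\<Sum>i=1..n. (norm (\<delta> i))\<^sup>2)"
    by (simp add: nm power2_norm_eq_inner del: One_nat_def)
  finally have var: "(\<Sum>i=1..n. (norm (a i))\<^sup>2) \<le> (\<Sum>i=1..n. (norm (\<delta> i))\<^sup>2)" .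
  have "(\<Sum>xs\<in>S. (norm (D + (1 / real b) *\<^sub>R (\<Sum>i\<leftarrow>xs. \<delta> i) - m))\<^sup>2)
      = (\<Sum>xs\<in>S. (norm (D + (1 / real b) *\<^sub>R (\<Sum>i\<leftarrow>xs. a i)))\<^sup>2)"
  proof (intro sum.cong refl)
    fix xs assume "xs \<in> S"
    then have "length xs = b" by (simp add: S_def batches_def)
    then have "(1 / real b) *\<^sub>R (\<Sum>i\<leftarrow>xs. a i) = (1 / real b) *\<^sub>R (\<Sum>i\<leftarrow>xs. \<delta> i) - m"
      using b by (simp add: a_def sum_list_diff_const scaleR_diff_right)
    then show "(norm (D + (1 / real b) *\<^sub>R (\<Sum>i\<leftarrow>xs. \<delta> i) - m))\<^sup>2
        = (norm (D + (1 / real b) *\<^sub>R (\<Sum>i\<leftarrow>xs. a i)))\<^sup>2"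
      by (simp add: add_diff_eq)
  qed
  also have "\<dots> = (\<Sum>xs\<in>S. (norm D)\<^sup>2 + (2 / real b) * (D \<bullet> (\<Sum>i\<leftarrow>xs. a i))
        + (1 / real b)\<^sup>2 * (norm (\<Sum>i\<leftarrow>xs. a i))\<^sup>2)"
    unfolding power2_norm_eq_inner
    by (intro sum.cong refl) (simp add: algebra_simps inner_commute power2_eq_square)
  also have "\<dots> = N * (norm D)\<^sup>2 + (2 / real b) * (D \<bullet> (\<Sum>xs\<in>S. \<Sum>i\<leftarrow>xs. a i))
        + (1 / real b)\<^sup>2 * (\<Sum>xs\<in>S. (norm (\<Sum>i\<leftarrow>xs. a i))\<^sup>2)"
    by (simp only: sum.distrib sum_constant N_def inner_sum_right sum_distrib_left)
  also have "\<dots> = N * (norm D)\<^sup>2 + (1 / real b)\<^sup>2 * (\<Sum>xs\<in>S. (norm (\<Sum>i\<leftarrow>xs. a i))\<^sup>2)"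
    by (simp add: lin)
  also have "(\<Sum>xs\<in>S. (norm (\<Sum>i\<leftarrow>xs. a i))\<^sup>2) \<le> real b * N * (\<Sum>i=1..n. (norm (\<delta> i))\<^sup>2) / real n"
  proof -
    have "real n * (\<Sum>xs\<in>S. (norm (\<Sum>i\<leftarrow>xs. a i))\<^sup>2) \<le> real b * N * (\<Sum>i=1..n. (norm (a i))\<^sup>2)"
      using sum_batches_norm_sum_le[OF repl a0] by (simp add: S_def N_def)
    also have "\<dots> \<le> real b * N * (\<Sum>i=1..n. (norm (\<delta> i))\<^sup>2)"
      using var N by (intro mult_left_mono) auto
    finally show ?thesis using n by (simp add: field_simps)
  qed
  finally have "(\<Sum>xs\<in>S. (norm (D + (1 / real b) *\<^sub>R (\<Sum>i\<leftarrow>xs. \<delta> i) - m))\<^sup>2)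
      \<le> N * (norm D)\<^sup>2 + (1 / real b)\<^sup>2 * (real b * N * (\<Sum>i=1..n. (norm (\<delta> i))\<^sup>2) / real n)"
    by (simp add: mult_left_mono)
  also have "\<dots> = N * ((norm D)\<^sup>2 + (\<Sum>i=1..n. (norm (\<delta> i))\<^sup>2) / (real b * real n))"
    using b n by (simp add: field_simps power2_eq_square)
  finally show ?thesis
    using N by (simp add: field_simps m_def S_def N_def)
qed

section \<open>Averaging over a fresh uniform variable\<close>

lemma (in prob_space) uniform_AE_prob:
  assumes X: "random_variable (count_space UNIV) X"
    and law: "distr M (count_space UNIV) X = measure_pmf (pmf_of_set S)"
    and S: "finite S" "S \<noteq> {}"
  shows "AE \<omega> in M. X \<omega> \<in> S" and "x \<in> S \<Longrightarrow> prob {\<omega> \<in> space M. X \<omega> = x} = 1 / real (card S)"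
proof -
  have "AE x in distr M (count_space UNIV) X. x \<in> S"
    unfolding law using S by (simp add: AE_measure_pmf_iff)
  then show "AE \<omega> in M. X \<omega> \<in> S"
    by (subst (asm) AE_distr_iff[OF X]) auto
  assume "x \<in> S"
  have "prob {\<omega> \<in> space M. X \<omega> = x} = measure (distr M (count_space UNIV) X) {x}"
    using X by (subst measure_distr) (auto intro: arg_cong[where f=prob])
  also have "\<dots> = 1 / real (card S)"
    unfolding law using S \<open>x \<in> S\<close> by (simp add: measure_pmf_single)
  finally show "prob {\<omega> \<in> space M. X \<omega> = x} = 1 / real (card S)" .
qed

text \<open>
  Dependence on the coordinates in \<open>J\<close> only. For finite \<open>J\<close> and countable values it replaces
  measurability with respect to the sigma-algebra of those coordinates.
\<close>

definition depends_on :: "(('i \<Rightarrow> 'a) \<Rightarrow> 'b) \<Rightarrow> 'i set \<Rightarrow> bool" where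
  "depends_on F J \<longleftrightarrow> (\<forall>x y. (\<forall>j\<in>J. x j = y j) \<longrightarrow> F x = F y)"

lemma depends_onD: "depends_on F J \<Longrightarrow> \<forall>j\<in>J. x j = y j \<Longrightarrow> F x = F y"
  by (auto simp: depends_on_def)

lemma depends_on_restrict: "depends_on F J \<Longrightarrow> F (restrict x J) = F x"
  by (auto simp: depends_on_def)

lemma depends_on_mono: "depends_on F J \<Longrightarrow> J \<subseteq> K \<Longrightarrow> depends_on F K"
  unfolding depends_on_def by blast

text \<open>A finite product of countable discrete spaces is discrete.\<close>

lemma measurable_PiM_count_space:
  fixes F :: "('i \<Rightarrow> 'a::countable) \<Rightarrow> 'b"
  assumes "finite J" "space N = UNIV"
  shows "F \<in> measurable (PiM J (\<lambda>_. count_space UNIV)) N"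
  using assms by (simp add: count_space_PiM_finite)

lemma (in prob_space) random_variable_depends_on:
  fixes X :: "'i \<Rightarrow> 'a \<Rightarrow> 'c::countable" and F :: "('i \<Rightarrow> 'c) \<Rightarrow> 'b::topological_space"
  assumes "finite J" "\<And>j. j \<in> J \<Longrightarrow> random_variable (count_space UNIV) (X j)" "depends_on F J"
  shows "random_variable borel (\<lambda>\<omega>. F (\<lambda>j. X j \<omega>))"
proof -
  have "(\<lambda>\<omega>. restrict (\<lambda>j. X j \<omega>) J) \<in> measurable M (PiM J (\<lambda>_. count_space UNIV))"
    using assms(2) by (intro measurable_restrict) auto
  from measurable_compose[OF this measurable_PiM_count_space[OF assms(1), of borel F]]
  show ?thesis by (simp add: depends_on_restrict[OF assms(3)])
qed

text \<open>
  Up to a null set the coordinates in \<open>J\<close> take finitely many joint values, so that \<open>F\<close> is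
  almost surely bounded.
\<close>

lemma (in prob_space) integrable_depends_on:
  fixes X :: "'i \<Rightarrow> 'a \<Rightarrow> 'c::countable" and F :: "('i \<Rightarrow> 'c) \<Rightarrow> real"
  assumes J: "finite J" and rv: "\<And>j. j \<in> J \<Longrightarrow> random_variable (count_space UNIV) (X j)"
    and F: "depends_on F J"
    and S: "finite S" "\<And>j. j \<in> J \<Longrightarrow> AE \<omega> in M. X j \<omega> \<in> S"
  shows "integrable M (\<lambda>\<omega>. F (\<lambda>j. X j \<omega>))"
proof -
  define P where "P = PiE J (\<lambda>_. S)"
  have "finite P" using J S by (auto simp: P_def intro: finite_PiE)
  have "AE \<omega> in M. \<forall>j\<in>J. X j \<omega> \<in> S"
    using J S(2) by (intro AE_finite_allI)
  then have "AE \<omega> in M. norm (F (\<lambda>j. X j \<omega>)) \<le> (\<Sum>x\<in>P. norm (F x))"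
  proof eventually_elim
    case (elim \<omega>)
    then have "restrict (\<lambda>j. X j \<omega>) J \<in> P" by (auto simp: P_def)
    then have "norm (F (restrict (\<lambda>j. X j \<omega>) J)) \<le> (\<Sum>x\<in>P. norm (F x))"
      using \<open>finite P\<close> by (intro member_le_sum[where f = "\<lambda>x. norm (F x)"]) simp_all
    then show ?case by (simp add: depends_on_restrict[OF F])
  qed
  then show ?thesis
    by (rule integrable_const_bound) (rule random_variable_depends_on[OF J rv F])
qed

text \<open>
  Conditioning on the coordinates in \<open>J\<close>: a further independent coordinate, uniform on a finite set,
  may be averaged out inside the expectation. Since that set is finite, it suffices to decompose
  along the events that the coordinate equals \<open>x\<close> and to use independence for products.
\<close>

lemma (in prob_space) expectation_average_fresh:
  fixes X :: "'i \<Rightarrow> 'a \<Rightarrow> 'c::countable" and F :: "('i \<Rightarrow> 'c) \<Rightarrow> 'c \<Rightarrow> real"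
  assumes ind: "indep_vars (\<lambda>_. count_space UNIV) X I"
    and law: "\<And>j. j \<in> I \<Longrightarrow> distr M (count_space UNIV) (X j) = measure_pmf (pmf_of_set S)"
    and S: "finite S" "S \<noteq> {}"
    and J: "finite J" "J \<subseteq> I" and i: "i \<in> I - J"
    and F: "\<And>x. depends_on (\<lambda>\<beta>. F \<beta> x) J"
  shows "expectation (\<lambda>\<omega>. F (\<lambda>j. X j \<omega>) (X i \<omega>))
           = expectation (\<lambda>\<omega>. (\<Sum>x\<in>S. F (\<lambda>j. X j \<omega>) x) / real (card S))"
proof -
  have rv: "random_variable (count_space UNIV) (X j)" if "j \<in> I" for j
    using ind that by (auto simp: indep_vars_def2)
  have AE: "AE \<omega> in M. X j \<omega> \<in> S" if "j \<in> I" for j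
    by (rule uniform_AE_prob(1)[OF rv[OF that] law[OF that] S])
  define E where "E x \<omega> = (if X i \<omega> = x then 1 else 0 :: real)" for x \<omega>
  have intF: "integrable M (\<lambda>\<omega>. F (\<lambda>j. X j \<omega>) x)" for x
    using J rv AE by (intro integrable_depends_on[OF J(1) _ F S(1)]) auto
  have "integrable M (\<lambda>\<omega>. (\<lambda>\<beta>. if \<beta> i = x then 1 else 0 :: real) (\<lambda>j. X j \<omega>))" for x
    using rv AE i S by (intro integrable_depends_on[of "{i}" X _ S]) (auto simp: depends_on_def)
  then have intE: "integrable M (E x)" for x
    unfolding E_def by simp
  have indep: "indep_var borel (\<lambda>\<omega>. F (\<lambda>j. X j \<omega>) x) borel (E x)" for x
  proof -
    have "indep_var borel ((\<lambda>\<beta>. F \<beta> x) \<circ> (\<lambda>\<omega>. restrict (\<lambda>j. X j \<omega>) J))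
        borel ((\<lambda>\<beta>. if \<beta> i = x then 1 else 0 :: real) \<circ> (\<lambda>\<omega>. restrict (\<lambda>j. X j \<omega>) {i}))"
      using J i
      by (intro indep_var_compose[OF indep_var_restrict[OF ind]] measurable_PiM_count_space) auto
    moreover have "(\<lambda>\<beta>. F \<beta> x) \<circ> (\<lambda>\<omega>. restrict (\<lambda>j. X j \<omega>) J) = (\<lambda>\<omega>. F (\<lambda>j. X j \<omega>) x)"
      using depends_on_restrict[OF F] by (auto simp: fun_eq_iff)
    moreover have "(\<lambda>\<beta>. if \<beta> i = x then 1 else 0 :: real) \<circ> (\<lambda>\<omega>. restrict (\<lambda>j. X j \<omega>) {i}) = E x"
      by (auto simp: E_def fun_eq_iff)
    ultimately show ?thesis by simp
  qed
  have expE: "expectation (E x) = 1 / real (card S)" if "x \<in> S" for x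
  proof -
    have "expectation (E x) = expectation (indicator {\<omega> \<in> space M. X i \<omega> = x})"
      by (intro Bochner_Integration.integral_cong) (auto simp: E_def indicator_def)
    also have "\<dots> = prob {\<omega> \<in> space M. X i \<omega> = x}"
      using rv[of i] i by simp
    also have "\<dots> = 1 / real (card S)"
      using i that by (intro uniform_AE_prob(2)[OF rv law S]) auto
    finally show ?thesis .
  qed
  have split: "F (\<lambda>j. X j \<omega>) (X i \<omega>) = (\<Sum>x\<in>S. F (\<lambda>j. X j \<omega>) x * E x \<omega>)"
    if "X i \<omega> \<in> S" for \<omega>
  proof -
    have "(\<Sum>x\<in>S. F (\<lambda>j. X j \<omega>) x * E x \<omega>) = (\<Sum>x\<in>S. if x = X i \<omega> then F (\<lambda>j. X j \<omega>) x else 0)"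
      by (intro sum.cong) (auto simp: E_def)
    then show ?thesis using that S by simp
  qed
  have rvL: "random_variable borel (\<lambda>\<omega>. F (\<lambda>j. X j \<omega>) (X i \<omega>))"
  proof -
    have "depends_on (\<lambda>\<beta>. F \<beta> (\<beta> i)) (insert i J)"
      using F unfolding depends_on_def by (metis insert_iff)
    from random_variable_depends_on[OF _ _ this, of X] show ?thesis
      using J i rv by auto
  qed
  have "expectation (\<lambda>\<omega>. F (\<lambda>j. X j \<omega>) (X i \<omega>))
      = expectation (\<lambda>\<omega>. \<Sum>x\<in>S. F (\<lambda>j. X j \<omega>) x * E x \<omega>)"
  proof (rule integral_cong_AE[OF rvL])
    show "random_variable borel (\<lambda>\<omega>. \<Sum>x\<in>S. F (\<lambda>j. X j \<omega>) x * E x \<omega>)"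
      using intF intE by (intro borel_measurable_sum borel_measurable_times) auto
    show "AE \<omega> in M. F (\<lambda>j. X j \<omega>) (X i \<omega>) = (\<Sum>x\<in>S. F (\<lambda>j. X j \<omega>) x * E x \<omega>)"
      using AE[of i] i by (auto elim!: eventually_mono intro: split)
  qed
  also have "\<dots> = (\<Sum>x\<in>S. expectation (\<lambda>\<omega>. F (\<lambda>j. X j \<omega>) x * E x \<omega>))"
    by (intro Bochner_Integration.integral_sum indep_var_integrable indep intF intE)
  also have "\<dots> = (\<Sum>x\<in>S. expectation (\<lambda>\<omega>. F (\<lambda>j. X j \<omega>) x) * (1 / real (card S)))"
    by (intro sum.cong refl) (simp add: indep_var_lebesgue_integral[OF indep intF intE] expE)
  also have "\<dots> = expectation (\<lambda>\<omega>. (\<Sum>x\<in>S. F (\<lambda>j. X j \<omega>) x) / real (card S))"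
    using intF by (simp add: Bochner_Integration.integral_sum sum_divide_distrib)
  finally show ?thesis .
qed

section \<open>Descent and summation along one inner loop\<close>

text \<open>
  The quadratic upper bound for a function with Lipschitz gradient. Along the segment, the difference
  between the function and its quadratic model has a nonpositive derivative, which avoids integrating
  the gradient.
\<close>

lemma descent_lemma:
  fixes V :: "'a::real_inner \<Rightarrow> real"
  assumes V: "\<And>x. GDERIV V x :> G x" and G: "L-lipschitz_on UNIV G"
  shows "V (x + u) \<le> V x + G x \<bullet> u + L / 2 * (norm u)\<^sup>2"
proof -
  define \<phi> where "\<phi> s = V (x + s *\<^sub>R u) - s * (G x \<bullet> u) - L / 2 * s\<^sup>2 * (norm u)\<^sup>2" for s
  have der: "(\<phi> has_real_derivative
      (G (x + s *\<^sub>R u) \<bullet> u - G x \<bullet> u - L * s * (norm u)\<^sup>2)) (at s)" for s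
  proof -
    have V': "(V has_derivative (\<lambda>v. v \<bullet> G (x + s *\<^sub>R u))) (at (x + s *\<^sub>R u))"
      using V[of "x + s *\<^sub>R u"] by (simp add: gderiv_def)
    have line: "((\<lambda>s. x + s *\<^sub>R u) has_derivative (\<lambda>s. s *\<^sub>R u)) (at s)"
      by (auto intro!: derivative_eq_intros)
    have "((\<lambda>s. V (x + s *\<^sub>R u)) has_derivative
        (\<lambda>r. (r *\<^sub>R u) \<bullet> G (x + s *\<^sub>R u))) (at s)"
      by (rule has_derivative_compose[OF line V'])
    moreover have "(\<lambda>r. (r *\<^sub>R u) \<bullet> G (x + s *\<^sub>R u)) = (*) (G (x + s *\<^sub>R u) \<bullet> u)"
      by (simp add: fun_eq_iff inner_commute)
    ultimately have 1: "((\<lambda>s. V (x + s *\<^sub>R u)) has_real_derivative G (x + s *\<^sub>R u) \<bullet> u) (at s)"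
      unfolding has_field_derivative_def by simp
    have 2: "((\<lambda>s. s * (G x \<bullet> u)) has_real_derivative G x \<bullet> u) (at s)"
      by (auto intro!: derivative_eq_intros)
    have 3: "((\<lambda>s. L / 2 * s\<^sup>2 * (norm u)\<^sup>2) has_real_derivative L * s * (norm u)\<^sup>2) (at s)"
      by (auto intro!: derivative_eq_intros)
    show ?thesis
      unfolding \<phi>_def by (intro DERIV_diff 1 2 3)
  qed
  have nonpos: "G (x + s *\<^sub>R u) \<bullet> u - G x \<bullet> u - L * s * (norm u)\<^sup>2 \<le> 0" if "0 \<le> s" for s
  proof -
    have "G (x + s *\<^sub>R u) \<bullet> u - G x \<bullet> u = (G (x + s *\<^sub>R u) - G x) \<bullet> u"
      by (simp add: inner_diff_left)
    also have "\<dots> \<le> norm (G (x + s *\<^sub>R u) - G x) * norm u"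
      by (rule norm_cauchy_schwarz)
    also have "\<dots> \<le> (L * (s * norm u)) * norm u"
      using lipschitz_onD[OF G, of "x + s *\<^sub>R u" x] that
      by (intro mult_right_mono) (auto simp: dist_norm)
    finally show ?thesis by (simp add: power2_eq_square algebra_simps)
  qed
  have "\<phi> 1 \<le> \<phi> 0"
  proof (rule DERIV_nonpos_imp_nonincreasing[where f = \<phi>])
    fix s :: real assume "0 \<le> s" "s \<le> 1"
    then show "\<exists>y. DERIV \<phi> s :> y \<and> y \<le> 0"
      using der nonpos by blast
  qed simp
  then show ?thesis by (simp add: \<phi>_def)
qed

text \<open>
  Weighting the error recursion by the step sizes: since they decrease, passing from \<open>g k * d k\<close> to
  \<open>g (k + 1) * d (k + 1)\<close> costs at most \<open>c * (g k)^3 * q k\<close>, and every weighted error is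
  bounded by the sum of all these costs.
\<close>

lemma sum_weighted_error_le:
  fixes g d q :: "nat \<Rightarrow> real"
  assumes q: "\<And>k. 0 \<le> q k" and d: "\<And>k. 0 \<le> d k" and "0 \<le> c" and d1: "d 1 = 0"
    and g: "\<And>k. k \<in> {1..m} \<Longrightarrow> 0 < g k"
    and decr: "\<And>k. 1 \<le> k \<Longrightarrow> k + 1 \<le> m \<Longrightarrow> g (k + 1) \<le> g k"
    and rec: "\<And>k. 1 \<le> k \<Longrightarrow> k + 1 \<le> m \<Longrightarrow> d (k + 1) \<le> d k + c * (g k)\<^sup>2 * q k"
  shows "(\<Sum>k=1..m. g k * d k) \<le> real m * c * (\<Sum>k=1..m. (g k)^3 * q k)"
proof -
  have step: "g (Suc k) * d (Suc k) \<le> c * (\<Sum>j=1..k. (g j)^3 * q j)" if "Suc k \<le> m" for k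
    using that
  proof (induction k)
    case 0
    then show ?case using d1 by simp
  next
    case (Suc k)
    let ?k = "Suc k"
    have gk: "0 < g ?k" "0 < g (Suc ?k)" using g[of ?k] g[of "Suc ?k"] Suc.prems by auto
    have le: "g (Suc ?k) \<le> g ?k" using decr[of ?k] Suc.prems by simp
    have "g (Suc ?k) * d (Suc ?k) \<le> g ?k * (d ?k + c * (g ?k)\<^sup>2 * q ?k)"
      using le gk d rec[of ?k] Suc.prems by (intro mult_mono) auto
    also have "\<dots> = g ?k * d ?k + c * ((g ?k)^3 * q ?k)"
      by (simp add: algebra_simps power2_eq_square power3_eq_cube)
    also have "\<dots> \<le> c * (\<Sum>j=1..k. (g j)^3 * q j) + c * ((g ?k)^3 * q ?k)"
      using Suc by simp
    finally show ?case by (simp add: distrib_left)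
  qed
  have "(\<Sum>k=1..m. g k * d k) \<le> (\<Sum>k=1..m. c * (\<Sum>j=1..m. (g j)^3 * q j))"
  proof (rule sum_mono)
    fix k assume k: "k \<in> {1..m}"
    then have "g k * d k \<le> c * (\<Sum>j=1..k-1. (g j)^3 * q j)"
      using step[of "k - 1"] by simp
    also have "\<dots> \<le> c * (\<Sum>j=1..m. (g j)^3 * q j)"
    proof (intro mult_left_mono sum_mono2 \<open>0 \<le> c\<close>)
      fix j assume "j \<in> {1..m} - {1..k - 1}"
      then have "0 < g j" using g by simp
      then show "0 \<le> (g j)^3 * q j" using q by simp
    qed (use k in auto)
    finally show "g k * d k \<le> c * (\<Sum>j=1..m. (g j)^3 * q j)" .
  qed
  then show ?thesis by simp
qed

text \<open>
  The deterministic core of the argument, with \<open>v\<close>, \<open>W\<close>, \<open>d\<close> and \<open>q\<close> standing for the expectations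
  of $V(w_k)$, $W(w_{k-1})$, $\|D_k\|^2$ and $\|H_k\|^2$. Half of the weight \<open>K\<close> of the errors comes
  from Young's inequality; \<open>sum_weighted_error_le\<close> converts it into a multiple of the \<open>g\<^sup>3 q\<close>, which
  joins the smoothness terms \<open>g\<^sup>2 q\<close> to form the coefficients \<open>lam\<close>. The factor 2 in the bound on
  \<open>q\<close> then cancels the remaining halves.
\<close>

lemma inner_loop_summation:
  fixes v W d q g :: "nat \<Rightarrow> real"
  assumes q: "\<And>k. 0 \<le> q k" and d: "\<And>k. 0 \<le> d k" and d1: "d 1 = 0"
    and nonneg: "0 \<le> \<sigma>" "0 \<le> K" "0 \<le> L"
    and g: "\<And>k. k \<in> {1..m} \<Longrightarrow> 0 < g k"
    and decr: "\<And>k. 1 \<le> k \<Longrightarrow> k + 1 \<le> m \<Longrightarrow> g (k + 1) \<le> g k"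
    and descent: "\<And>k. k \<in> {1..m} \<Longrightarrow>
          v k \<le> v (k - 1) + g k * (- (\<rho> / 2) * W k + (K - \<rho>) / 2 * d k) + L / 2 * (g k)\<^sup>2 * q k"
    and mean_sq: "\<And>k. k \<in> {1..m} \<Longrightarrow> q k \<le> 2 * (c0 + c1 * W k + d k)"
    and variance: "\<And>k. 1 \<le> k \<Longrightarrow> k + 1 \<le> m \<Longrightarrow> d (k + 1) \<le> d k + \<sigma> * (g k)\<^sup>2 * q k"
    and lam: "\<And>k. k \<in> {1..m} \<Longrightarrow> lam k = L + g k * (K * \<sigma> * real m)"
  shows "(\<Sum>k=1..m. g k * (\<rho> / 2 - c1 * g k * lam k) * W k)
           + (\<Sum>k=1..m. g k * (\<rho> / 2 - g k * lam k) * d k)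
         \<le> v 0 - v m + c0 * (L * (\<Sum>k=1..m. (g k)\<^sup>2) + K * \<sigma> * real m * (\<Sum>k=1..m. (g k)^3))"
proof -
  have tele: "v 0 - v m = (\<Sum>k=1..m. v (k - 1) - v k)"
    by (induction m) simp_all
  have err: "K / 2 * (\<Sum>k=1..m. g k * d k) \<le> K / 2 * (real m * \<sigma> * (\<Sum>k=1..m. (g k)^3 * q k))"
  proof (rule mult_left_mono)
    show "(\<Sum>k=1..m. g k * d k) \<le> real m * \<sigma> * (\<Sum>k=1..m. (g k)^3 * q k)"
      by (rule sum_weighted_error_le[where g = g and d = d and q = q])
         (fact q d d1 nonneg g decr variance)+
  qed (use nonneg in simp)
  have "(\<Sum>k=1..m. \<rho> / 2 * g k * W k + \<rho> / 2 * g k * d k)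
      \<le> (\<Sum>k=1..m. (v (k - 1) - v k) + K / 2 * (g k * d k) + L / 2 * (g k)\<^sup>2 * q k)"
  proof (rule sum_mono)
    fix k assume k: "k \<in> {1..m}"
    have "g k * (- (\<rho> / 2) * W k + (K - \<rho>) / 2 * d k)
        = - (\<rho> / 2 * g k * W k + \<rho> / 2 * g k * d k) + K / 2 * (g k * d k)"
      by (simp add: field_simps)
    then show "\<rho> / 2 * g k * W k + \<rho> / 2 * g k * d k
        \<le> (v (k - 1) - v k) + K / 2 * (g k * d k) + L / 2 * (g k)\<^sup>2 * q k"
      using descent[OF k] by linarith
  qed
  also have "\<dots> = (v 0 - v m) + K / 2 * (\<Sum>k=1..m. g k * d k) + (\<Sum>k=1..m. L / 2 * (g k)\<^sup>2 * q k)"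
    unfolding tele by (simp only: sum.distrib sum_distrib_left)
  also have "\<dots> \<le> (v 0 - v m) + K / 2 * (real m * \<sigma> * (\<Sum>k=1..m. (g k)^3 * q k))
        + (\<Sum>k=1..m. L / 2 * (g k)\<^sup>2 * q k)"
    using err by simp
  also have "\<dots> = (v 0 - v m) + (\<Sum>k=1..m. (g k)\<^sup>2 * lam k / 2 * q k)"
  proof -
    have "(g k)\<^sup>2 * lam k / 2 * q k
        = K / 2 * (real m * \<sigma> * ((g k)^3 * q k)) + L / 2 * (g k)\<^sup>2 * q k"
      if "k \<in> {1..m}" for k
      unfolding lam[OF that] by (simp add: field_simps power2_eq_square power3_eq_cube)
    then have "(\<Sum>k=1..m. (g k)\<^sup>2 * lam k / 2 * q k)
        = (\<Sum>k=1..m. K / 2 * (real m * \<sigma> * ((g k)^3 * q k)) + L / 2 * (g k)\<^sup>2 * q k)"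
      by (rule sum.cong[OF refl])
    then show ?thesis by (simp only: sum_distrib_left sum.distrib add.assoc)
  qed
  also have "\<dots> \<le> (v 0 - v m) + (\<Sum>k=1..m. (g k)\<^sup>2 * lam k * (c0 + c1 * W k + d k))"
  proof (intro add_left_mono sum_mono)
    fix k assume k: "k \<in> {1..m}"
    have "0 \<le> lam k" using lam[OF k] g[OF k] nonneg by simp
    then have "(g k)\<^sup>2 * lam k / 2 * q k \<le> (g k)\<^sup>2 * lam k / 2 * (2 * (c0 + c1 * W k + d k))"
      using mean_sq[OF k] by (intro mult_left_mono) auto
    then show "(g k)\<^sup>2 * lam k / 2 * q k \<le> (g k)\<^sup>2 * lam k * (c0 + c1 * W k + d k)"
      by (simp add: algebra_simps)
  qed
  also have "\<dots> = (v 0 - v m) + (\<Sum>k=1..m. c1 * (g k)\<^sup>2 * lam k * W k)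
      + (\<Sum>k=1..m. (g k)\<^sup>2 * lam k * d k) + c0 * (\<Sum>k=1..m. (g k)\<^sup>2 * lam k)"
  proof -
    have "(g k)\<^sup>2 * lam k * (c0 + c1 * W k + d k)
        = c1 * (g k)\<^sup>2 * lam k * W k + (g k)\<^sup>2 * lam k * d k + c0 * ((g k)\<^sup>2 * lam k)" for k
      by (simp add: algebra_simps)
    then show ?thesis by (simp only: sum_distrib_left sum.distrib add.assoc)
  qed
  also have "(\<Sum>k=1..m. (g k)\<^sup>2 * lam k)
      = L * (\<Sum>k=1..m. (g k)\<^sup>2) + K * \<sigma> * real m * (\<Sum>k=1..m. (g k)^3)"
  proof -
    have "(g k)\<^sup>2 * lam k = L * (g k)\<^sup>2 + K * \<sigma> * real m * (g k)^3" if "k \<in> {1..m}" for k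
      unfolding lam[OF that] by (simp add: algebra_simps power2_eq_square power3_eq_cube)
    then have "(\<Sum>k=1..m. (g k)\<^sup>2 * lam k)
        = (\<Sum>k=1..m. L * (g k)\<^sup>2 + K * \<sigma> * real m * (g k)^3)"
      by (rule sum.cong[OF refl])
    then show ?thesis by (simp only: sum_distrib_left sum.distrib)
  qed
  finally have bound: "(\<Sum>k=1..m. \<rho> / 2 * g k * W k + \<rho> / 2 * g k * d k)
      \<le> (v 0 - v m) + (\<Sum>k=1..m. c1 * (g k)\<^sup>2 * lam k * W k)
        + (\<Sum>k=1..m. (g k)\<^sup>2 * lam k * d k)
        + c0 * (L * (\<Sum>k=1..m. (g k)\<^sup>2) + K * \<sigma> * real m * (\<Sum>k=1..m. (g k)^3))" .
  have "(\<Sum>k=1..m. g k * (\<rho> / 2 - c1 * g k * lam k) * W k)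
      = (\<Sum>k=1..m. \<rho> / 2 * g k * W k) - (\<Sum>k=1..m. c1 * (g k)\<^sup>2 * lam k * W k)"
    unfolding sum_subtractf[symmetric]
    by (intro sum.cong refl) (simp add: algebra_simps power2_eq_square)
  moreover have "(\<Sum>k=1..m. g k * (\<rho> / 2 - g k * lam k) * d k)
      = (\<Sum>k=1..m. \<rho> / 2 * g k * d k) - (\<Sum>k=1..m. (g k)\<^sup>2 * lam k * d k)"
    unfolding sum_subtractf[symmetric]
    by (intro sum.cong refl) (simp add: algebra_simps power2_eq_square)
  ultimately show ?thesis using bound unfolding sum.distrib by linarith
qed

section \<open>The random run of the algorithm\<close>

lemma spider_inner_cong:
  "(\<And>j. 1 \<le> j \<Longrightarrow> j \<le> k \<Longrightarrow> B j = B' j)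
     \<Longrightarrow> spider_inner n hs b g B w0 k = spider_inner n hs b g B' w0 k"
  by (induction k) simp_all

lemma spider_outer_cong:
  "(\<And>s j. 1 \<le> s \<Longrightarrow> s \<le> t \<Longrightarrow> 1 \<le> j \<Longrightarrow> j \<le> kin \<Longrightarrow> B s j = B' s j)
     \<Longrightarrow> spider_outer n hs b kin g B winit t = spider_outer n hs b kin g B' winit t"
proof (induction t)
  case (Suc t)
  have "spider_outer n hs b kin g B winit t = spider_outer n hs b kin g B' winit t"
    by (rule Suc.IH) (simp add: Suc.prems)
  moreover have "spider_inner n hs b (g (Suc t)) (B (Suc t)) w0 kin
      = spider_inner n hs b (g (Suc t)) (B' (Suc t)) w0 kin" for w0
    by (rule spider_inner_cong) (simp add: Suc.prems)
  ultimately show ?case by simp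
qed simp

text \<open>The indices of the batches drawn before or at inner step \<open>k\<close> of outer iteration \<open>t\<close>.\<close>

definition past :: "nat \<Rightarrow> nat \<Rightarrow> nat \<Rightarrow> (nat \<times> nat) set" where
  "past kin t k = {1..<t} \<times> {1..kin} \<union> {t} \<times> {1..k}"

lemma spider_depends_on_past:
  assumes "1 \<le> t"
  shows "depends_on (\<lambda>\<beta>. spider_w n hs b kin g (curry \<beta>) winit t k) (past kin t k)"
    and "depends_on (\<lambda>\<beta>. spider_H n hs b kin g (curry \<beta>) winit t k) (past kin t k)"
proof -
  have "spider_inner n hs b (g t) (curry x t) (spider_outer n hs b kin g (curry x) winit (t - 1)) k
      = spider_inner n hs b (g t) (curry y t) (spider_outer n hs b kin g (curry y) winit (t - 1)) k"
    if eq: "\<forall>j\<in>past kin t k. x j = y j" for x y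
  proof -
    have "spider_outer n hs b kin g (curry x) winit (t - 1)
        = spider_outer n hs b kin g (curry y) winit (t - 1)"
      using eq assms by (intro spider_outer_cong) (auto simp: past_def)
    moreover have "spider_inner n hs b (g t) (curry x t) w0 k
        = spider_inner n hs b (g t) (curry y t) w0 k" for w0
      using eq by (intro spider_inner_cong) (auto simp: past_def)
    ultimately show ?thesis by simp
  qed
  then show "depends_on (\<lambda>\<beta>. spider_w n hs b kin g (curry \<beta>) winit t k) (past kin t k)"
    and "depends_on (\<lambda>\<beta>. spider_H n hs b kin g (curry \<beta>) winit t k) (past kin t k)"
    unfolding depends_on_def spider_w_def spider_H_def by metis+
qed

lemma mean_field_diff:
  "mean_field n hs x - mean_field n hs y = (1 / real n) *\<^sub>R (\<Sum>i=1..n. hs i x - hs i y)"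
  by (simp add: mean_field_def sum_subtractf scaleR_diff_right)

text \<open>
  The sampling assumptions and the Lipschitz bounds on the \<open>hs i\<close>, without the Lyapunov functions:
  they alone control the error of the estimated field.
\<close>

locale spider_run = prob_space M
  for M :: "'\<omega> measure" +
  fixes hs :: "nat \<Rightarrow> 'v \<Rightarrow> 'v::real_inner"
    and n b kin kout :: nat and repl :: bool and Ls :: "nat \<Rightarrow> real"
    and \<gamma> :: "nat \<Rightarrow> nat \<Rightarrow> real" and winit :: 'v
    and B :: "nat \<Rightarrow> nat \<Rightarrow> '\<omega> \<Rightarrow> nat list"
  assumes n: "1 \<le> n" and b: "1 \<le> b" and kout: "1 \<le> kout"
    and repl: "repl \<or> b \<le> n"
    and h_lip: "\<And>i x y. i \<in> {1..n} \<Longrightarrow> norm (hs i x - hs i y) \<le> Ls i * norm (x - y)"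
    and B_law: "\<And>t k. t \<in> {1..kout} \<Longrightarrow> k \<in> {1..kin} \<Longrightarrow>
          distr M (count_space UNIV) (B t k) = measure_pmf (pmf_of_set (batches repl n b))"
    and B_indep: "indep_vars (\<lambda>_. count_space UNIV) (\<lambda>(t, k). B t k) ({1..kout} \<times> {1..kin})"
begin

abbreviation h :: "'v \<Rightarrow> 'v" where
  "h \<equiv> mean_field n hs"

abbreviation w :: "nat \<Rightarrow> nat \<Rightarrow> '\<omega> \<Rightarrow> 'v" where
  "w t k \<omega> \<equiv> spider_w n hs b kin \<gamma> (\<lambda>s j. B s j \<omega>) winit t k"

abbreviation H :: "nat \<Rightarrow> nat \<Rightarrow> '\<omega> \<Rightarrow> 'v" where
  "H t k \<omega> \<equiv> spider_H n hs b kin \<gamma> (\<lambda>s j. B s j \<omega>) winit t k"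

definition L2 :: real where
  "L2 = (1 / real n) * (\<Sum>i=1..n. (Ls i)\<^sup>2)"

definition mean_sq_error :: "nat \<Rightarrow> nat \<Rightarrow> real" where
  "mean_sq_error t k = expectation (\<lambda>\<omega>. (norm (H t k \<omega> - h (w t (k - 1) \<omega>)))\<^sup>2)"

definition mean_sq_field :: "nat \<Rightarrow> nat \<Rightarrow> real" where
  "mean_sq_field t k = expectation (\<lambda>\<omega>. (norm (H t k \<omega>))\<^sup>2)"

lemma L2_nonneg: "0 \<le> L2"
  unfolding L2_def by (intro mult_nonneg_nonneg sum_nonneg) auto

lemma curry_batches: "curry (\<lambda>j. (case j of (t, k) \<Rightarrow> B t k) \<omega>) = (\<lambda>s j. B s j \<omega>)"
  by (simp add: fun_eq_iff)

lemma past_subset: "t \<le> kout \<Longrightarrow> 1 \<le> t \<Longrightarrow> k \<le> kin \<Longrightarrow> past kin t k \<subseteq> {1..kout} \<times> {1..kin}"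
  by (auto simp: past_def)

text \<open>
  The iterates are functions of finitely many batches, each with finitely many possible values, so
  that \<open>f\<close> is evaluated almost surely at finitely many points.
\<close>

lemma integrable_run:
  assumes "t \<in> {1..kout}" "k \<le> kin" "j \<le> kin"
  shows "integrable M (\<lambda>\<omega>. f (w t k \<omega>) (w t j \<omega>) (H t k \<omega>) :: real)"
proof -
  let ?I = "{1..kout} \<times> {1..kin}"
  let ?X = "\<lambda>(t, k). B t k"
  have dep: "depends_on (\<lambda>\<beta>. spider_w n hs b kin \<gamma> (curry \<beta>) winit t i) ?I"
    "depends_on (\<lambda>\<beta>. spider_H n hs b kin \<gamma> (curry \<beta>) winit t i) ?I" if "i \<le> kin" for i
    using assms(1) that past_subset[of t i]
    by (auto intro: depends_on_mono[OF spider_depends_on_past(1)]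
        depends_on_mono[OF spider_depends_on_past(2)])
  define F where "F \<beta> = f (spider_w n hs b kin \<gamma> (curry \<beta>) winit t k)
      (spider_w n hs b kin \<gamma> (curry \<beta>) winit t j) (spider_H n hs b kin \<gamma> (curry \<beta>) winit t k)" for \<beta> :: "nat \<times> nat \<Rightarrow> nat list"
  have rv: "random_variable (count_space UNIV) (?X i)" if "i \<in> ?I" for i
    using B_indep that unfolding indep_vars_def2 by blast
  have "AE \<omega> in M. ?X i \<omega> \<in> batches repl n b" if "i \<in> ?I" for i
    using that B_law batches_nonempty[OF n repl] by (intro uniform_AE_prob[OF rv]) auto
  moreover have "depends_on F ?I"
    unfolding depends_on_def
  proof (intro allI impI)
    fix \<beta> \<beta>' :: "nat \<times> nat \<Rightarrow> nat list" assume eq: "\<forall>i\<in>?I. \<beta> i = \<beta>' i"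
    show "F \<beta> = F \<beta>'"
      unfolding F_def
      by (simp only: depends_onD[OF dep(1)[OF assms(2)] eq] depends_onD[OF dep(1)[OF assms(3)] eq]
          depends_onD[OF dep(2)[OF assms(2)] eq])
  qed
  ultimately have "integrable M (\<lambda>\<omega>. F (\<lambda>i. ?X i \<omega>))"
    using rv by (intro integrable_depends_on[where J = ?I and S = "batches repl n b"]) auto
  then show ?thesis by (simp add: F_def curry_batches)
qed

text \<open>
  The first inner step compares the field at two equal points, so the full field computed at the
  start of the loop is kept unchanged.
\<close>

lemma mean_sq_error_first: "mean_sq_error t 1 = 0"
proof -
  have "H t 1 \<omega> = h (w t 0 \<omega>)" for \<omega>
    using spider_step(1)[OF refl refl, of n hs b kin \<gamma> "\<lambda>s j. B s j \<omega>" winit t 0]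
    by (simp add: spider_start(3))
  then show ?thesis by (simp add: mean_sq_error_def)
qed

text \<open>
  Given the past, the error at step \<open>k + 1\<close> is the error at step \<open>k\<close> plus a centred batch mean of
  the increments \<open>hs i (w t k) - hs i (w t (k - 1))\<close>. By the Lipschitz bounds their mean square is
  at most \<open>L2\<close> times the squared length of the last step.
\<close>

lemma mean_sq_error_step:
  assumes t: "t \<in> {1..kout}" and k: "1 \<le> k" "k + 1 \<le> kin"
  shows "mean_sq_error t (k + 1) \<le> mean_sq_error t k + L2 / real b * (\<gamma> t k)\<^sup>2 * mean_sq_field t k"
proof -
  let ?S = "batches repl n b"
  let ?X = "\<lambda>(t, k). B t k"
  define f :: "'v \<Rightarrow> 'v \<Rightarrow> 'v \<Rightarrow> nat list \<Rightarrow> real" where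
    "f u u' G x = (norm (G + (1 / real b) *\<^sub>R (\<Sum>i\<leftarrow>x. hs i u - hs i u') - h u))\<^sup>2" for u u' G and x :: "nat list"
  define F where "F \<beta> = f (spider_w n hs b kin \<gamma> (curry \<beta>) winit t k)
      (spider_w n hs b kin \<gamma> (curry \<beta>) winit t (k - 1))
      (spider_H n hs b kin \<gamma> (curry \<beta>) winit t k)" for \<beta> :: "nat \<times> nat \<Rightarrow> nat list"
  have FX: "F (\<lambda>j. ?X j \<omega>) = f (w t k \<omega>) (w t (k - 1) \<omega>) (H t k \<omega>)" for \<omega>
    by (simp add: F_def curry_batches)
  have sub: "past kin t (k - 1) \<subseteq> past kin t k" by (auto simp: past_def)
  have "1 \<le> t" using t by simp
  note dep = spider_depends_on_past[OF this, of n hs b kin \<gamma> winit]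
  have dep1: "depends_on (\<lambda>\<beta>. spider_w n hs b kin \<gamma> (curry \<beta>) winit t (k - 1)) (past kin t k)"
    by (rule depends_on_mono[OF dep(1) sub])
  have depF: "depends_on (\<lambda>\<beta>. F \<beta> x) (past kin t k)" for x
    unfolding depends_on_def
  proof (intro allI impI)
    fix \<beta> \<beta>' :: "nat \<times> nat \<Rightarrow> nat list" assume eq: "\<forall>j\<in>past kin t k. \<beta> j = \<beta>' j"
    show "F \<beta> x = F \<beta>' x"
      unfolding F_def
      by (simp only: depends_onD[OF dep(1) eq] depends_onD[OF dep(2) eq] depends_onD[OF dep1 eq])
  qed
  have lip: "(\<Sum>i=1..n. (norm (hs i u - hs i u'))\<^sup>2) \<le> real n * L2 * (norm (u - u'))\<^sup>2" for u u'
  proof -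
    have "(\<Sum>i=1..n. (norm (hs i u - hs i u'))\<^sup>2) \<le> (\<Sum>i=1..n. (Ls i * norm (u - u'))\<^sup>2)"
      by (intro sum_mono power_mono h_lip) auto
    then show ?thesis
      using n by (simp add: L2_def power_mult_distrib sum_distrib_right[symmetric])
  qed
  have avg: "(\<Sum>x\<in>?S. f u u' G x) / real (card ?S)
      \<le> (norm (G - h u'))\<^sup>2 + L2 / real b * (norm (u - u'))\<^sup>2" for u u' G
  proof -
    have centre: "G - h u' + (1 / real b) *\<^sub>R (\<Sum>i\<leftarrow>x. hs i u - hs i u')
          - (1 / real n) *\<^sub>R (\<Sum>i=1..n. hs i u - hs i u')
        = G + (1 / real b) *\<^sub>R (\<Sum>i\<leftarrow>x. hs i u - hs i u') - h u" for x
      unfolding mean_field_diff[symmetric] by simp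
    have "(\<Sum>x\<in>?S. f u u' G x) / real (card ?S)
        \<le> (norm (G - h u'))\<^sup>2 + (\<Sum>i=1..n. (norm (hs i u - hs i u'))\<^sup>2) / (real b * real n)"
      using batch_mean_second_moment[OF n b repl, of "G - h u'" "\<lambda>i. hs i u - hs i u'"]
      unfolding f_def centre .
    also have "(\<Sum>i=1..n. (norm (hs i u - hs i u'))\<^sup>2) / (real b * real n)
        \<le> real n * L2 * (norm (u - u'))\<^sup>2 / (real b * real n)"
      by (intro divide_right_mono lip) auto
    finally show ?thesis using n by simp
  qed
  have "mean_sq_error t (k + 1) = expectation (\<lambda>\<omega>. F (\<lambda>j. ?X j \<omega>) (?X (t, k + 1) \<omega>))"
    unfolding mean_sq_error_def FX
    using spider_step(1)[OF refl refl, of n hs b kin \<gamma> _ winit t k] by (simp add: f_def)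
  also have "\<dots> = expectation (\<lambda>\<omega>. (\<Sum>x\<in>?S. F (\<lambda>j. ?X j \<omega>) x) / real (card ?S))"
    using t k B_law batches_nonempty[OF n repl] past_subset[of t k]
    by (intro expectation_average_fresh[OF B_indep, where J = "past kin t k"] depF)
       (auto simp: past_def)
  also have "\<dots> \<le> expectation (\<lambda>\<omega>. (norm (H t k \<omega> - h (w t (k - 1) \<omega>)))\<^sup>2
      + L2 / real b * (norm (w t k \<omega> - w t (k - 1) \<omega>))\<^sup>2)"
    unfolding FX using t k by (intro integral_mono avg integrable_run) auto
  also have "\<dots> = expectation (\<lambda>\<omega>. (norm (H t k \<omega> - h (w t (k - 1) \<omega>)))\<^sup>2
      + L2 / real b * (\<gamma> t k)\<^sup>2 * (norm (H t k \<omega>))\<^sup>2)"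
  proof -
    have "w t k \<omega> - w t (k - 1) \<omega> = \<gamma> t k *\<^sub>R H t k \<omega>" for \<omega>
      using spider_step(2)[OF refl refl, of n hs b kin \<gamma> "\<lambda>s j. B s j \<omega>" winit t "k - 1"] k by simp
    then show ?thesis by (simp add: power_mult_distrib mult.assoc)
  qed
  also have "\<dots> = mean_sq_error t k + L2 / real b * (\<gamma> t k)\<^sup>2 * mean_sq_field t k"
  proof -
    have "integrable M (\<lambda>\<omega>. (norm (H t k \<omega> - h (w t (k - 1) \<omega>)))\<^sup>2)"
      "integrable M (\<lambda>\<omega>. (norm (H t k \<omega>))\<^sup>2)"
      using t k by (auto intro!: integrable_run)
    then show ?thesis by (simp add: mean_sq_error_def mean_sq_field_def)
  qed
  finally show ?thesis .
qed

lemma mean_sq_error_eq_0: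
  assumes "L2 = 0" "t \<in> {1..kout}" "1 \<le> k" "k \<le> kin"
  shows "mean_sq_error t k = 0"
  using assms(3,4)
proof (induction k rule: nat_induct_at_least)
  case base
  then show ?case using mean_sq_error_first by simp
next
  case (Suc k)
  have "mean_sq_error t (Suc k) \<le> 0"
    using mean_sq_error_step[OF assms(2), of k] Suc assms(1) by simp
  moreover have "0 \<le> mean_sq_error t (Suc k)" by (simp add: mean_sq_error_def)
  ultimately show ?case by simp
qed

text \<open>
  The alternative \<open>L2 = 0\<close> is needed when \<open>G\<close> has no finite bound relative to \<open>sqrt W\<close>: the error
  then vanishes almost surely, and the claim reduces to the nonnegativity of \<open>W\<close>.
\<close>

lemma AE_inner_error_le:
  fixes G :: "'v \<Rightarrow> 'v" and W :: "'v \<Rightarrow> real"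
  assumes t: "t \<in> {1..kout}" and k: "k \<in> {1..kin}" and W: "\<And>x. 0 \<le> W x" and \<rho>: "0 < \<rho>"
    and young: "L2 = 0 \<or> (\<forall>x u. G x \<bullet> u \<le> \<rho> / 2 * W x + (K - \<rho>) / 2 * (norm u)\<^sup>2)"
  shows "AE \<omega> in M. G (w t (k - 1) \<omega>) \<bullet> (H t k \<omega> - h (w t (k - 1) \<omega>))
           \<le> \<rho> / 2 * W (w t (k - 1) \<omega>) + (K - \<rho>) / 2 * (norm (H t k \<omega> - h (w t (k - 1) \<omega>)))\<^sup>2"
  using young
proof
  assume "L2 = 0"
  then have "expectation (\<lambda>\<omega>. (norm (H t k \<omega> - h (w t (k - 1) \<omega>)))\<^sup>2) = 0"
    using mean_sq_error_eq_0[of t k] t k by (simp add: mean_sq_error_def)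
  moreover have "integrable M (\<lambda>\<omega>. (norm (H t k \<omega> - h (w t (k - 1) \<omega>)))\<^sup>2)"
    using t k by (auto intro!: integrable_run)
  ultimately have "AE \<omega> in M. (norm (H t k \<omega> - h (w t (k - 1) \<omega>)))\<^sup>2 = 0"
    by (subst (asm) integral_nonneg_eq_0_iff_AE) auto
  then show ?thesis
  proof eventually_elim
    case (elim \<omega>)
    then have "H t k \<omega> - h (w t (k - 1) \<omega>) = 0" by simp
    then show ?case using W \<rho> by simp
  qed
qed auto

text \<open>
  The hypotheses of \<open>inner_loop_summation\<close> hold for the expectations along one inner loop: the
  descent inequality and the bound on the size of the field are integrated pathwise estimates.
\<close>

lemma inner_loop_bound:
  fixes V W :: "'v \<Rightarrow> real" and G :: "'v \<Rightarrow> 'v"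
  assumes W: "\<And>x. 0 \<le> W x" and bound: "\<And>x. (norm (h x))\<^sup>2 \<le> c0 + c1 * W x"
    and V: "\<And>x. GDERIV V x :> G x" and lip: "L-lipschitz_on UNIV G"
    and \<rho>: "0 < \<rho>" and drift: "\<And>x. G x \<bullet> h x \<le> - \<rho> * W x" and "0 \<le> K"
    and young: "L2 = 0 \<or> (\<forall>x u. G x \<bullet> u \<le> \<rho> / 2 * W x + (K - \<rho>) / 2 * (norm u)\<^sup>2)"
    and t: "t \<in> {1..kout}"
    and pos: "\<And>k. k \<in> {1..kin} \<Longrightarrow> 0 < \<gamma> t k"
    and decr: "\<And>k. 1 \<le> k \<Longrightarrow> k + 1 \<le> kin \<Longrightarrow> \<gamma> t (k + 1) \<le> \<gamma> t k"
    and lam: "\<And>k. k \<in> {1..kin} \<Longrightarrow> lam k = L + \<gamma> t k * (K * (L2 / real b) * real kin)"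
  shows "(\<Sum>k=1..kin. \<gamma> t k * (\<rho> / 2 - c1 * \<gamma> t k * lam k) * expectation (\<lambda>\<omega>. W (w t (k - 1) \<omega>)))
           + (\<Sum>k=1..kin. \<gamma> t k * (\<rho> / 2 - \<gamma> t k * lam k) * mean_sq_error t k)
         \<le> expectation (\<lambda>\<omega>. V (w t 0 \<omega>)) - expectation (\<lambda>\<omega>. V (w t kin \<omega>))
           + c0 * (L * (\<Sum>k=1..kin. (\<gamma> t k)\<^sup>2) + K * (L2 / real b) * real kin * (\<Sum>k=1..kin. (\<gamma> t k)^3))"
proof (rule inner_loop_summation)
  show "0 \<le> mean_sq_field t k" "0 \<le> mean_sq_error t k" for k
    by (simp_all add: mean_sq_field_def mean_sq_error_def)
  show "mean_sq_error t 1 = 0" by (rule mean_sq_error_first)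
  show "0 \<le> L2 / real b" "0 \<le> K" "0 \<le> L"
    using L2_nonneg \<open>0 \<le> K\<close> lipschitz_on_nonneg[OF lip] by auto
  show "mean_sq_error t (k + 1) \<le> mean_sq_error t k + L2 / real b * (\<gamma> t k)\<^sup>2 * mean_sq_field t k"
    if "1 \<le> k" "k + 1 \<le> kin" for k
    by (rule mean_sq_error_step[OF t that])
next
  fix k assume k: "k \<in> {1..kin}"
  define D where "D \<omega> = H t k \<omega> - h (w t (k - 1) \<omega>)" for \<omega>
  have int: "integrable M (\<lambda>\<omega>. V (w t k \<omega>))" "integrable M (\<lambda>\<omega>. V (w t (k - 1) \<omega>))"
    "integrable M (\<lambda>\<omega>. W (w t (k - 1) \<omega>))" "integrable M (\<lambda>\<omega>. (norm (D \<omega>))\<^sup>2)"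
    "integrable M (\<lambda>\<omega>. (norm (H t k \<omega>))\<^sup>2)"
    unfolding D_def using t k by (auto intro!: integrable_run)
  have err: "mean_sq_error t k = expectation (\<lambda>\<omega>. (norm (D \<omega>))\<^sup>2)"
    by (simp add: mean_sq_error_def D_def)
  have "AE \<omega> in M. G (w t (k - 1) \<omega>) \<bullet> D \<omega>
      \<le> \<rho> / 2 * W (w t (k - 1) \<omega>) + (K - \<rho>) / 2 * (norm (D \<omega>))\<^sup>2"
    unfolding D_def by (rule AE_inner_error_le[OF t k W \<rho> young])
  then have "AE \<omega> in M. V (w t k \<omega>) \<le> V (w t (k - 1) \<omega>)
      + \<gamma> t k * (- (\<rho> / 2) * W (w t (k - 1) \<omega>) + (K - \<rho>) / 2 * (norm (D \<omega>))\<^sup>2)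
      + L / 2 * (\<gamma> t k)\<^sup>2 * (norm (H t k \<omega>))\<^sup>2"
  proof eventually_elim
    case (elim \<omega>)
    let ?x = "w t (k - 1) \<omega>"
    have "w t k \<omega> = ?x + \<gamma> t k *\<^sub>R H t k \<omega>"
      using spider_step(2)[OF refl refl, of n hs b kin \<gamma> "\<lambda>s j. B s j \<omega>" winit t "k - 1"] k by simp
    then have "V (w t k \<omega>) \<le> V ?x + G ?x \<bullet> (\<gamma> t k *\<^sub>R H t k \<omega>) + L / 2 * (norm (\<gamma> t k *\<^sub>R H t k \<omega>))\<^sup>2"
      using descent_lemma[OF V lip, of ?x "\<gamma> t k *\<^sub>R H t k \<omega>"] by simp
    also have "G ?x \<bullet> (\<gamma> t k *\<^sub>R H t k \<omega>) = \<gamma> t k * (G ?x \<bullet> h ?x + G ?x \<bullet> D \<omega>)"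
      by (simp add: D_def inner_diff_right)
    also have "\<dots> \<le> \<gamma> t k * (- (\<rho> / 2) * W ?x + (K - \<rho>) / 2 * (norm (D \<omega>))\<^sup>2)"
      using elim drift[of ?x] pos[OF k] by (intro mult_left_mono) (auto simp: field_simps)
    finally show ?case by (simp add: power_mult_distrib mult.assoc)
  qed
  from integral_mono_AE[OF int(1) _ this]
  show "expectation (\<lambda>\<omega>. V (w t k \<omega>)) \<le> expectation (\<lambda>\<omega>. V (w t (k - 1) \<omega>))
      + \<gamma> t k * (- (\<rho> / 2) * expectation (\<lambda>\<omega>. W (w t (k - 1) \<omega>)) + (K - \<rho>) / 2 * mean_sq_error t k)
      + L / 2 * (\<gamma> t k)\<^sup>2 * mean_sq_field t k"
    using int by (simp add: err mean_sq_field_def)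
  have "(norm (H t k \<omega>))\<^sup>2 \<le> 2 * c0 + 2 * c1 * W (w t (k - 1) \<omega>) + 2 * (norm (D \<omega>))\<^sup>2" for \<omega>
  proof -
    let ?h = "h (w t (k - 1) \<omega>)"
    \<comment> \<open>The parallelogram identity gives the constant 2.\<close>
    have "(norm (D \<omega> + ?h))\<^sup>2 \<le> (norm (D \<omega> + ?h))\<^sup>2 + (norm (D \<omega> - ?h))\<^sup>2" by simp
    also have "\<dots> = 2 * (norm (D \<omega>))\<^sup>2 + 2 * (norm ?h)\<^sup>2"
      by (simp add: power2_norm_eq_inner algebra_simps inner_commute)
    also have "\<dots> \<le> 2 * (norm (D \<omega>))\<^sup>2 + 2 * (c0 + c1 * W (w t (k - 1) \<omega>))"
      using bound[of "w t (k - 1) \<omega>"] by simp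
    finally show ?thesis by (simp add: D_def)
  qed
  then have "expectation (\<lambda>\<omega>. (norm (H t k \<omega>))\<^sup>2)
      \<le> expectation (\<lambda>\<omega>. 2 * c0 + 2 * c1 * W (w t (k - 1) \<omega>) + 2 * (norm (D \<omega>))\<^sup>2)"
    using int by (intro integral_mono) auto
  then show "mean_sq_field t k
      \<le> 2 * (c0 + c1 * expectation (\<lambda>\<omega>. W (w t (k - 1) \<omega>)) + mean_sq_error t k)"
    using int by (simp add: mean_sq_field_def err prob_space)
qed (use pos decr lam in auto)

text \<open>
  Outer iterations are chained through \<open>w (t + 1) 0 = w t kin\<close>, so that only the initial value of
  \<open>V\<close> and its final expectation remain; the latter is at least the infimum.
\<close>

lemma all_loops_bound:
  fixes V W :: "'v \<Rightarrow> real" and G :: "'v \<Rightarrow> 'v"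
  assumes W: "\<And>x. 0 \<le> W x" and bound: "\<And>x. (norm (h x))\<^sup>2 \<le> c0 + c1 * W x"
    and V: "\<And>x. GDERIV V x :> G x" and bdd: "bdd_below (range V)" and lip: "L-lipschitz_on UNIV G"
    and \<rho>: "0 < \<rho>" and drift: "\<And>x. G x \<bullet> h x \<le> - \<rho> * W x" and K: "0 \<le> K"
    and young: "L2 = 0 \<or> (\<forall>x u. G x \<bullet> u \<le> \<rho> / 2 * W x + (K - \<rho>) / 2 * (norm u)\<^sup>2)"
    and pos: "\<And>t k. t \<in> {1..kout} \<Longrightarrow> k \<in> {1..kin} \<Longrightarrow> 0 < \<gamma> t k"
    and decr: "\<And>t k. t \<in> {1..kout} \<Longrightarrow> 1 \<le> k \<Longrightarrow> k + 1 \<le> kin \<Longrightarrow> \<gamma> t (k + 1) \<le> \<gamma> t k"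
    and lam: "\<And>t k. lam t k = L + \<gamma> t k * (K * (L2 / real b) * real kin)"
  shows "(\<Sum>t=1..kout. \<Sum>k=1..kin.
             \<gamma> t k * (\<rho> / 2 - c1 * \<gamma> t k * lam t k) * expectation (\<lambda>\<omega>. W (w t (k - 1) \<omega>)))
           + (\<Sum>t=1..kout. \<Sum>k=1..kin. \<gamma> t k * (\<rho> / 2 - \<gamma> t k * lam t k) * mean_sq_error t k)
         \<le> V winit - (INF x. V x)
           + c0 * (L * (\<Sum>t=1..kout. \<Sum>k=1..kin. (\<gamma> t k)\<^sup>2)
                + K * (L2 / real b) * real kin * (\<Sum>t=1..kout. \<Sum>k=1..kin. (\<gamma> t k)^3))"
    (is "?lhs \<le> _ - _ + c0 * ?C")
proof -
  define v where "v t = expectation (\<lambda>\<omega>. V (w t kin \<omega>))" for t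
  define start where "start t = expectation (\<lambda>\<omega>. V (w t 0 \<omega>))" for t
  have start1: "start 1 = V winit"
    by (simp add: start_def spider_start(1)[simplified] prob_space)
  have next_loop: "start (Suc t) = v t" if "1 \<le> t" for t
    using that by (simp add: start_def v_def spider_start(2))
  have tele: "(\<Sum>t=1..m. start t - v t) = start 1 - v m" if "1 \<le> m" for m
    using that by (induction m rule: nat_induct_at_least) (simp_all add: next_loop)
  have "?lhs = (\<Sum>t=1..kout.
        (\<Sum>k=1..kin. \<gamma> t k * (\<rho> / 2 - c1 * \<gamma> t k * lam t k) * expectation (\<lambda>\<omega>. W (w t (k - 1) \<omega>)))
      + (\<Sum>k=1..kin. \<gamma> t k * (\<rho> / 2 - \<gamma> t k * lam t k) * mean_sq_error t k))"
    by (rule sum.distrib[symmetric])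
  also have "\<dots> \<le> (\<Sum>t=1..kout. start t - v t
      + c0 * (L * (\<Sum>k=1..kin. (\<gamma> t k)\<^sup>2) + K * (L2 / real b) * real kin * (\<Sum>k=1..kin. (\<gamma> t k)^3)))"
    unfolding start_def v_def
    by (intro sum_mono inner_loop_bound[OF W bound V lip \<rho> drift K young] pos decr lam)
  also have "\<dots> = start 1 - v kout + c0 * ?C"
    by (simp only: sum.distrib tele[OF kout] sum_distrib_left distrib_left)
  also have "\<dots> \<le> V winit - (INF x. V x) + c0 * ?C"
  proof -
    have "(INF x. V x) = expectation (\<lambda>\<omega>. INF x. V x)" by (simp add: prob_space)
    also have "\<dots> \<le> v kout"
      unfolding v_def using kout bdd
      by (intro integral_mono integrable_run) (auto intro: cINF_lower)
    finally show ?thesis unfolding start1 by simp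
  qed
  finally show ?thesis .
qed

end

section \<open>The finite-time bound\<close>

theorem theorem7:
  fixes M :: "'\<omega> measure"
    and hs :: "nat \<Rightarrow> real ^ 'd \<Rightarrow> real ^ 'd" and h :: "real ^ 'd \<Rightarrow> real ^ 'd"
    and W V :: "real ^ 'd \<Rightarrow> real" and gradV :: "real ^ 'd \<Rightarrow> real ^ 'd"
    and n b kin kout :: nat and repl :: bool
    and ch0 ch1 LV \<rho> L2 :: real and Ls :: "nat \<Rightarrow> real" and cV :: ereal
    and \<gamma> :: "nat \<Rightarrow> nat \<Rightarrow> real" and winit :: "real ^ 'd"
    and B :: "nat \<Rightarrow> nat \<Rightarrow> '\<omega> \<Rightarrow> nat list"
    and w H :: "nat \<Rightarrow> nat \<Rightarrow> '\<omega> \<Rightarrow> real ^ 'd"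
    and \<Lambda> :: "nat \<Rightarrow> nat \<Rightarrow> ereal"
  assumes n: "1 \<le> n" and b: "1 \<le> b" and kin: "1 \<le> kin" and kout: "1 \<le> kout"
    and h: "h = mean_field n hs"
    and W_nonneg: "\<forall>x. 0 \<le> W x" and W_borel: "W \<in> borel_measurable borel"
    and ch_nonneg: "0 \<le> ch0" "0 \<le> ch1"
    and h_bound: "\<forall>x. (norm (h x))\<^sup>2 \<le> ch0 + ch1 * W x"
    and V_deriv: "\<forall>x. GDERIV V x :> gradV x" and V_C1: "continuous_on UNIV gradV"
    and V_bdd: "bdd_below (range V)"
    and V_lip: "LV-lipschitz_on UNIV gradV"
    and \<rho>: "0 < \<rho>" and V_h: "\<forall>x. gradV x \<bullet> h x \<le> - \<rho> * W x"
    and h_lip: "\<forall>i\<in>{1..n}. 0 \<le> Ls i \<and> (\<forall>x y. norm (hs i x - hs i y) \<le> Ls i * norm (x - y))"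
    and L2: "L2 = (1 / real n) * (\<Sum>i=1..n. (Ls i)\<^sup>2)"
    and cV: "0 < cV" and gradV_bound: "\<forall>x. ereal (norm (gradV x)) \<le> cV * ereal (sqrt (W x))"
    and \<Lambda>: "\<forall>t k. \<Lambda> t k = spider_lambda LV L2 cV \<rho> kin b (\<gamma> t k)"
    and \<gamma>_pos: "\<forall>t\<in>{1..kout}. \<forall>k\<in>{1..kin}. 0 < \<gamma> t k"
    and \<gamma>_decr: "\<forall>t\<in>{1..kout}. \<forall>k. 1 \<le> k \<and> k + 1 \<le> kin \<longrightarrow> \<gamma> t (k + 1) \<le> \<gamma> t k"
    and \<gamma>_range: "\<forall>t\<in>{1..kout}. \<forall>k\<in>{1..kin}.
           ereal (max 1 ch1 * \<gamma> t k) * \<Lambda> t k \<in> {0<..<ereal (\<rho> / 2)}"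
    and M: "prob_space M"
    and repl: "repl \<or> b \<le> n"
    and B_law: "\<forall>t\<in>{1..kout}. \<forall>k\<in>{1..kin}.
           distr M (count_space UNIV) (B t k) = measure_pmf (pmf_of_set (batches repl n b))"
    and B_indep: "prob_space.indep_vars M (\<lambda>_. count_space UNIV) (\<lambda>(t, k). B t k)
           ({1..kout} \<times> {1..kin})"
    and w: "\<forall>t k \<omega>. w t k \<omega> = spider_w n hs b kin \<gamma> (\<lambda>s j. B s j \<omega>) winit t k"
    and H: "\<forall>t k \<omega>. H t k \<omega> = spider_H n hs b kin \<gamma> (\<lambda>s j. B s j \<omega>) winit t k"
  shows "(\<Sum>t=1..kout. \<Sum>k=1..kin.
            ereal (\<gamma> t k) * (ereal (\<rho> / 2) - ereal (ch1 * \<gamma> t k) * \<Lambda> t k)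
              * ereal (prob_space.expectation M (\<lambda>\<omega>. W (w t (k - 1) \<omega>))))
       + (\<Sum>t=1..kout. \<Sum>k=1..kin.
            ereal (\<gamma> t k) * (ereal (\<rho> / 2) - ereal (\<gamma> t k) * \<Lambda> t k)
              * ereal (prob_space.expectation M
                  (\<lambda>\<omega>. (norm (H t k \<omega> - h (w t (k - 1) \<omega>)))\<^sup>2)))
     \<le> ereal (prob_space.expectation M (\<lambda>\<omega>. V winit)) - ereal (INF x. V x)
       + ereal ch0 *
           (ereal (LV * (\<Sum>t=1..kout. \<Sum>k=1..kin. (\<gamma> t k)\<^sup>2))
            + ereal (L2 * real kin / real b) * (cV\<^sup>2 / ereal \<rho> + ereal \<rho>)
                * ereal (\<Sum>t=1..kout. \<Sum>k=1..kin. (\<gamma> t k)^3))"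
proof -
  interpret S: spider_run M hs n b kin kout repl Ls \<gamma> winit B
    by (intro spider_run.intro spider_run_axioms.intro M) (use n b kout repl h_lip B_law B_indep in auto)
  have L2_eq: "S.L2 = L2"
    unfolding S.L2_def L2 ..
  have "0 \<le> L2"
    using S.L2_nonneg by (simp add: L2_eq)
  have \<gamma>11: "0 < \<gamma> 1 1"
    using \<gamma>_pos kin kout by simp
  \<comment> \<open>A real substitute for the possibly infinite constant \<open>cV\<^sup>2 / \<rho> + \<rho>\<close>. That constant occurs only
    multiplied by \<open>L2\<close>, so for \<open>L2 = 0\<close> any value would satisfy the last property.\<close>
  obtain K where "0 \<le> K"
    and young: "L2 = 0 \<or> (\<forall>x u. gradV x \<bullet> u \<le> \<rho> / 2 * W x + (K - \<rho>) / 2 * (norm u)\<^sup>2)"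
    and K_eq: "\<And>x. ereal (L2 * x) * (cV\<^sup>2 / ereal \<rho> + ereal \<rho>) = ereal (L2 * x * K)"
  proof (cases cV)
    case (real c)
    then have "0 < c" using cV by simp
    show thesis
    proof
      show "0 \<le> c\<^sup>2 / \<rho> + \<rho>" using \<rho> by simp
      show "ereal (L2 * x) * (cV\<^sup>2 / ereal \<rho> + ereal \<rho>) = ereal (L2 * x * (c\<^sup>2 / \<rho> + \<rho>))" for x
        using \<rho> by (simp add: real)
      have "gradV x \<bullet> u \<le> \<rho> / 2 * W x + (c\<^sup>2 / \<rho> + \<rho> - \<rho>) / 2 * (norm u)\<^sup>2" for x u
      proof -
        have "gradV x \<bullet> u \<le> norm (gradV x) * norm u"
          by (rule norm_cauchy_schwarz)
        also have "\<dots> \<le> c * sqrt (W x) * norm u"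
          using gradV_bound[rule_format, of x] by (intro mult_right_mono) (auto simp: real)
        \<comment> \<open>Young's inequality, from the square of \<open>\<rho> * sqrt (W x) - c * norm u\<close>.\<close>
        also have "\<dots> \<le> \<rho> / 2 * (sqrt (W x))\<^sup>2 + c\<^sup>2 / \<rho> / 2 * (norm u)\<^sup>2"
          using zero_le_power2[of "\<rho> * sqrt (W x) - c * norm u"] \<rho>
          by (simp add: field_simps power2_eq_square)
        finally show ?thesis using W_nonneg by simp
      qed
      then show "L2 = 0 \<or> (\<forall>x u. gradV x \<bullet> u
          \<le> \<rho> / 2 * W x + (c\<^sup>2 / \<rho> + \<rho> - \<rho>) / 2 * (norm u)\<^sup>2)"
        by blast
    qed
  next
    case PInf
    \<comment> \<open>Otherwise \<open>\<Lambda> 1 1\<close> would be infinite, against the upper bound on the step sizes.\<close>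
    have "L2 = 0"
    proof (rule ccontr)
      assume "L2 \<noteq> 0"
      then have "0 < L2" using \<open>0 \<le> L2\<close> by simp
      then have "\<Lambda> 1 1 = \<infinity>"
        using \<gamma>11 kin b \<rho> by (simp add: \<Lambda> spider_lambda_def PInf power2_eq_square)
      moreover have "0 < max 1 ch1 * \<gamma> 1 1"
        using \<gamma>11 by (intro mult_pos_pos) auto
      moreover have "ereal a * \<infinity> = \<infinity>" if "0 < a" for a
        using that by simp
      ultimately have "ereal (max 1 ch1 * \<gamma> 1 1) * \<Lambda> 1 1 = \<infinity>"
        by metis
      moreover have "ereal (max 1 ch1 * \<gamma> 1 1) * \<Lambda> 1 1 \<in> {0<..<ereal (\<rho> / 2)}"
        by (rule \<gamma>_range[rule_format]) (use kin kout in auto)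
      ultimately show False
        by (simp only: greaterThanLessThan_iff) simp
    qed
    with \<rho> show thesis by (intro that[of \<rho>]) (simp_all add: zero_ereal_def[symmetric])
  next
    case MInf
    then show thesis using cV by simp
  qed
  define lam where "lam t k = LV + \<gamma> t k * (K * (L2 / real b) * real kin)" for t k
  have \<Lambda>_eq: "\<Lambda> t k = ereal (lam t k)" for t k
    using K_eq[of "\<gamma> t k"] by (simp add: \<Lambda> spider_lambda_def lam_def mult_ac)
  have const: "ereal (L2 * real kin / real b) * (cV\<^sup>2 / ereal \<rho> + ereal \<rho>)
      = ereal (K * (L2 / real b) * real kin)"
    using K_eq[of "real kin / real b"] by (simp add: mult_ac)
  have "(\<Sum>t=1..kout. \<Sum>k=1..kin.
          \<gamma> t k * (\<rho> / 2 - ch1 * \<gamma> t k * lam t k) * S.expectation (\<lambda>\<omega>. W (w t (k - 1) \<omega>)))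
        + (\<Sum>t=1..kout. \<Sum>k=1..kin. \<gamma> t k * (\<rho> / 2 - \<gamma> t k * lam t k)
             * S.expectation (\<lambda>\<omega>. (norm (H t k \<omega> - h (w t (k - 1) \<omega>)))\<^sup>2))
      \<le> V winit - (INF x. V x)
        + ch0 * (LV * (\<Sum>t=1..kout. \<Sum>k=1..kin. (\<gamma> t k)\<^sup>2)
            + K * (L2 / real b) * real kin * (\<Sum>t=1..kout. \<Sum>k=1..kin. (\<gamma> t k)^3))"
    unfolding w[rule_format] H[rule_format] h S.mean_sq_error_def[symmetric] L2_eq[symmetric]
    using W_nonneg h_bound V_deriv V_h young \<gamma>_pos \<gamma>_decr
    by (intro S.all_loops_bound[where G = gradV, OF _ _ _ V_bdd V_lip \<rho> _ \<open>0 \<le> K\<close>])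
       (auto simp: h L2_eq lam_def)
  then show ?thesis
    unfolding \<Lambda>_eq const by (simp add: S.prob_space del: One_nat_def)
qed

end
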